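(* Let $w$ be an integrable weight function on $[-1,1]$ with $w(x)>0$ almost everywhere, and let $n\ge1$. (1) Let $t_1,\ldots,t_n\in(-1,1)$ be distinct. If $x_i(t_1,\ldots,t_n,t)$ is the $i$th node for orthogonal quadrature with $n$ nodes $(1\le i\le n)$, then $x_i(t_1,\ldots,t_n,t)$ is a continuously differentiable and strictly decreasing function of $t\in(-1,1)$. (2) Let $t_1,\ldots,t_{2n-1}\in(-1,1)$ be distinct. Every node $x_i(t_1,\ldots,t_{2n-1},t)$ $(1\le i\le n)$ for Gaussian quadrature with $n$ nodes is a continuously differentiable and strictly decreasing function of $t\in(-1,1)$.
   Context: Nodes are numbered in increasing order, $x_1<x_2<\cdots<x_n$. Orthogonal quadrature: for $t\in(-1,1)$ different from $t_1,\ldots,t_n$, the nodes $x_i(t_1,\ldots,t_n,t)$ are the $n$ simple zeros in $(-1,1)$ of $r_{n+1}(t_1,\ldots,t_n,t;x)=\frac{1}{1+tx}+\sum_{j=1}^n\frac{c_j}{1+t_jx}$, where the real numbers $c_j$ are chosen so that $\int_{-1}^1 r_{n+1}(t_1,\ldots,t_n,t;x)\frac{w(x)}{1+t_jx}\,dx=0$ for $j=1,\ldots,n$. If $t=t_\ell$ for some $\ell$, the leading function $\frac1{1+tx}$ in this definition is replaced by $\frac{\partial}{\partial s}\frac{1}{1+sx}\big|_{s=t_\ell}$. Gaussian quadrature: for $t\in(-1,1)$ different from $t_1,\ldots,t_{2n-1}$, the nodes $x_i(t_1,\ldots,t_{2n-1},t)$ are the unique $n$ distinct points of $(-1,1)$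 for which there are strictly positive weights $\beta_1,\ldots,\beta_n$ such that $\int_{-1}^1\phi(x)w(x)\,dx=\sum_{i=1}^n\beta_i\phi(x_i)$ for the $2n$ functions $\phi(x)=\frac1{1+t_1x},\ldots,\frac{1}{1+t_{2n-1}x},\frac1{1+tx}$. If $t=t_\ell$ for some $\ell$, the last function is replaced by $\frac{\partial}{\partial s}\frac{1}{1+sx}\big|_{s=t_\ell}$. *)

theory Defs
  imports "HOL-Analysis.Analysis"
begin

definition rker :: "real \<Rightarrow> real \<Rightarrow> real" where
  "rker s x = 1 / (1 + s * x)"

text \<open>
  The function attached to the extra parameter \<open>t\<close>: the kernel at \<open>t\<close> itself, or its derivative
  with respect to the parameter when \<open>t\<close> coincides with one of \<open>\<tau> 1, \<dots>, \<tau> m\<close>.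
\<close>
definition lead_fun :: "nat \<Rightarrow> (nat \<Rightarrow> real) \<Rightarrow> real \<Rightarrow> real \<Rightarrow> real" where
  "lead_fun m \<tau> t x =
     (if t \<in> \<tau> ` {1..m} then deriv (\<lambda>s. rker s x) t else rker t x)"

definition wint :: "(real \<Rightarrow> real) \<Rightarrow> (real \<Rightarrow> real) \<Rightarrow> real" where
  "wint w f = (LINT x:{-1..1}|lebesgue. f x * w x)"

definition orth_fun :: "nat \<Rightarrow> (nat \<Rightarrow> real) \<Rightarrow> real \<Rightarrow> (nat \<Rightarrow> real) \<Rightarrow> real \<Rightarrow> real" where
  "orth_fun n \<tau> t c x = lead_fun n \<tau> t x + (\<Sum>j=1..n. c j * rker (\<tau> j) x)"

definition is_orth_nodes ::
  "(real \<Rightarrow> real) \<Rightarrow> nat \<Rightarrow> (nat \<Rightarrow> real) \<Rightarrow> real \<Rightarrow> real set \<Rightarrow> bool" where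
  "is_orth_nodes w n \<tau> t X \<longleftrightarrow>
     (\<exists>c. (\<forall>j\<in>{1..n}. wint w (\<lambda>x. orth_fun n \<tau> t c x * rker (\<tau> j) x) = 0) \<and>
          X = {x \<in> {-1<..<1}. orth_fun n \<tau> t c x = 0} \<and>
          finite X \<and> card X = n \<and>
          (\<forall>x\<in>X. deriv (orth_fun n \<tau> t c) x \<noteq> 0))"

definition is_gauss_nodes ::
  "(real \<Rightarrow> real) \<Rightarrow> nat \<Rightarrow> (nat \<Rightarrow> real) \<Rightarrow> real \<Rightarrow> real set \<Rightarrow> bool" where
  "is_gauss_nodes w n \<tau> t X \<longleftrightarrow>
     X \<subseteq> {-1<..<1} \<and> finite X \<and> card X = n \<and>
     (\<exists>\<beta>. (\<forall>x\<in>X. \<beta> x > 0) \<and>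
          (\<forall>j\<in>{1..2*n-1}. wint w (rker (\<tau> j)) = (\<Sum>x\<in>X. \<beta> x * rker (\<tau> j) x)) \<and>
          wint w (lead_fun (2*n-1) \<tau> t) = (\<Sum>x\<in>X. \<beta> x * lead_fun (2*n-1) \<tau> t x))"

text \<open>
  The \<open>i\<close>-th node (\<open>1 \<le> i \<le> n\<close>) in increasing order. The descriptions are meaningful when the node
  set exists and is unique.
\<close>
definition orth_node :: "(real \<Rightarrow> real) \<Rightarrow> nat \<Rightarrow> (nat \<Rightarrow> real) \<Rightarrow> nat \<Rightarrow> real \<Rightarrow> real" where
  "orth_node w n \<tau> i t = sorted_list_of_set (THE X. is_orth_nodes w n \<tau> t X) ! (i - 1)"

definition gauss_node :: "(real \<Rightarrow> real) \<Rightarrow> nat \<Rightarrow> (nat \<Rightarrow> real) \<Rightarrow> nat \<Rightarrow> real \<Rightarrow> real" where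
  "gauss_node w n \<tau> i t = sorted_list_of_set (THE X. is_gauss_nodes w n \<tau> t X) ! (i - 1)"

end

theory Submission
  imports Defs
begin

text \<open>
  Both statements are instances of Markov's theorem on the zeros of orthogonal polynomials. Over the common denominator
  \<open>(1 + t x) (1 + \<tau>\<^sub>1 x) \<dots> (1 + \<tau>\<^sub>m x)\<close> the kernels and the leading function span all quotients with numerator
  of degree at most \<open>m\<close>; this includes the confluent case in which \<open>t\<close> equals some \<open>\<tau>\<^sub>j\<close> and the
  denominator has a double factor. In terms of numerators, the nodes for orthogonal quadrature are the zeros of the
  \<open>n\<close>-th orthogonal polynomial for the weight \<open>w(x) / ((1 + t x) \<Prod>\<^sub>j (1 + \<tau>\<^sub>j x)\<^sup>2)\<close>, and the nodes for Gaussian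
  quadrature are those for the weight \<open>w(x) / ((1 + t x) \<Prod>\<^sub>j (1 + \<tau>\<^sub>j x))\<close> (lemmas \<open>is_orth_nodes_iff\<close>
  and \<open>is_gauss_nodes_iff\<close>). In both cases the weight is \<open>v(x) / (1 + t x)\<close> with \<open>v\<close> independent of \<open>t\<close>.

  For such a family of weights the orthogonal polynomial is \<open>P + a(t) R\<close>, where \<open>P\<close> and \<open>R\<close> are the
  orthogonal polynomials of degrees \<open>n\<close> and \<open>n - 1\<close> for \<open>v\<close> itself, and \<open>a\<close> is a quotient of two integrals that are
  continuously differentiable in \<open>t\<close> (lemma \<open>orth_poly_tilt\<close>). Its zeros are simple, so the ordered zeros are
  continuously differentiable as well (lemma \<open>ordered_zero_derivative\<close>).

  The zeros decrease because a larger \<open>t\<close> shifts the weight to the left: the logarithmic derivative of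
  \<open>1 / (1 + t x)\<close> in \<open>t\<close> is \<open>- x / (1 + t x)\<close>, a decreasing function of \<open>x\<close>. Lemma \<open>markov_sign\<close> turns
  this into the sign of the derivative of each zero, by differentiating an orthogonality relation and evaluating it with
  Gauss quadrature.
\<close>

section \<open>Integration against a positive weight\<close>

definition pos_weight :: "(real \<Rightarrow> real) \<Rightarrow> bool" where
  "pos_weight v \<longleftrightarrow> v absolutely_integrable_on {-1..1} \<and> (AE x\<in>{-1..1} in lebesgue. 0 < v x)"

lemma wint_integrable:
  fixes v f :: "real \<Rightarrow> real"
  assumes "v absolutely_integrable_on {-1..1}" and "continuous_on {-1..1} f"
  shows "(\<lambda>x. f x * v x) absolutely_integrable_on {-1..1}"
proof (rule absolutely_integrable_bounded_measurable_product_real[OF _ _ _ assms(1)])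
  show "f \<in> borel_measurable (lebesgue_on {-1..1})"
    using assms(2) by (intro continuous_imp_measurable_on_sets_lebesgue) auto
  show "bounded (f ` {-1..1})"
    using assms(2) compact_continuous_image compact_imp_bounded by blast
qed auto

lemma pos_weight_mult:
  assumes "pos_weight v" and "continuous_on {-1..1} g" and "\<And>x. x \<in> {-1..1} \<Longrightarrow> 0 < g x"
  shows "pos_weight (\<lambda>x. g x * v x)"
  unfolding pos_weight_def
proof
  show "(\<lambda>x. g x * v x) absolutely_integrable_on {-1..1}"
    using assms wint_integrable pos_weight_def by blast
  have "AE x\<in>{-1..1} in lebesgue. 0 < v x" using assms pos_weight_def by blast
  then show "AE x\<in>{-1..1} in lebesgue. 0 < g x * v x"
    by eventually_elim (use assms(3) in auto)
qed

lemma wint_cong: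
  assumes "\<And>x. x \<in> {-1..1} \<Longrightarrow> f x * v x = g x * u x"
  shows "wint v f = wint u g"
  unfolding wint_def using assms by (intro set_lebesgue_integral_cong) auto

lemma wint_mult_weight: "wint (\<lambda>x. g x * v x) f = wint v (\<lambda>x. f x * g x)"
  by (rule wint_cong) (simp add: mult.assoc)

lemma wint_add:
  assumes "pos_weight v" "continuous_on {-1..1} f" "continuous_on {-1..1} g"
  shows "wint v (\<lambda>x. f x + g x) = wint v f + wint v g"
  unfolding wint_def distrib_right
  using assms by (intro set_integral_add wint_integrable) (auto simp: pos_weight_def)

lemma wint_diff:
  assumes "pos_weight v" "continuous_on {-1..1} f" "continuous_on {-1..1} g"
  shows "wint v (\<lambda>x. f x - g x) = wint v f - wint v g"
  unfolding wint_def left_diff_distrib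
  using assms by (intro set_integral_diff wint_integrable) (auto simp: pos_weight_def)

lemma wint_cmult: "wint v (\<lambda>x. c * f x) = c * wint v f"
  by (simp add: wint_def mult.assoc)

lemma wint_sum:
  assumes "pos_weight v" "finite A" "\<And>i. i \<in> A \<Longrightarrow> continuous_on {-1..1} (f i)"
  shows "wint v (\<lambda>x. \<Sum>i\<in>A. f i x) = (\<Sum>i\<in>A. wint v (f i))"
  using assms(2,3)
proof (induction A rule: finite_induct)
  case empty
  then show ?case by (simp add: wint_def)
next
  case (insert a A)
  then show ?case
    using wint_add[OF assms(1), of "f a" "\<lambda>x. \<Sum>i\<in>A. f i x"] by (simp add: continuous_on_sum)
qed

text \<open>
  The zeros of \<open>f\<close> form a null set and the weight is positive almost everywhere, so a vanishing integral
  would make the interval \<open>{-1<..<1}\<close> a null set.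
\<close>
lemma wint_pos:
  assumes v: "pos_weight v" and f: "continuous_on {-1..1} f"
    and nonneg: "\<And>x. x \<in> {-1<..<1} \<Longrightarrow> 0 \<le> f x"
    and fin: "finite {x \<in> {-1<..<1}. f x = 0}"
  shows "0 < wint v f"
proof -
  define h where "h = (\<lambda>x. indicator {-1..1} x *\<^sub>R (f x * v x))"
  have int: "integrable lebesgue h"
    using wint_integrable[OF _ f, of v] v by (simp add: h_def pos_weight_def set_integrable_def)
  have wh: "wint v f = integral\<^sup>L lebesgue h"
    by (simp add: wint_def h_def set_lebesgue_integral_def)
  have vpos: "AE x\<in>{-1..1} in lebesgue. 0 < v x" using v pos_weight_def by blast
  have fnn: "0 \<le> f x" if "x \<in> {-1..1}" for x
  proof (rule continuous_ge_on_closure[of "{-1<..<1}" f x 0])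
    show "continuous_on (closure {-1<..<1}) f" using f by simp
  qed (use that nonneg in auto)
  have hnn: "AE x in lebesgue. 0 \<le> h x"
    using vpos by eventually_elim (auto simp: h_def indicator_def fnn)

  have "\<not> (AE x in lebesgue. h x = 0)"
  proof
    assume "AE x in lebesgue. h x = 0"
    moreover have "AE x in lebesgue. x \<notin> {x \<in> {-1<..<1}. f x = 0}"
      using fin by (intro AE_not_in) (simp add: finite_imp_null_set_lborel null_sets_completionI)
    ultimately have "AE x in lebesgue. x \<notin> {-1<..<1::real}"
      using vpos by eventually_elim (auto simp: h_def)
    then have "{-1<..<1::real} \<in> null_sets lebesgue"
      by (subst (asm) AE_iff_null_sets[symmetric]) auto
    then show False
      using emeasure_lborel_Ioo[of "-1" 1] by (simp add: null_sets_def)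
  qed
  then have "integral\<^sup>L lebesgue h \<noteq> 0"
    using integral_nonneg_eq_0_iff_AE[OF int hnn] by simp
  moreover have "integral\<^sup>L lebesgue h \<ge> 0" using hnn by (rule integral_nonneg_AE)
  ultimately show ?thesis using wh by simp
qed

lemma wint_abs_le:
  assumes v: "pos_weight v" and f: "continuous_on {-1..1} f" and b: "\<And>x. x \<in> {-1..1} \<Longrightarrow> \<bar>f x\<bar> \<le> e"
  shows "\<bar>wint v f\<bar> \<le> e * wint v (\<lambda>_. 1)"
proof -
  have ub: "0 \<le> wint v g" if g: "continuous_on {-1..1} g" "\<And>x. x \<in> {-1..1} \<Longrightarrow> 0 \<le> g x" for g
  proof -
    have "AE x\<in>{-1..1} in lebesgue. 0 < v x" using v pos_weight_def by blast
    then have "AE x in lebesgue. 0 \<le> indicator {-1..1} x *\<^sub>R (g x * v x)"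
      by eventually_elim (use g in \<open>auto simp: indicator_def\<close>)
    then show ?thesis unfolding wint_def set_lebesgue_integral_def by (rule integral_nonneg_AE)
  qed
  have c: "wint v (\<lambda>x. e) = e * wint v (\<lambda>_. 1)" using wint_cmult[of v e "\<lambda>_. 1"] by simp
  have "0 \<le> wint v (\<lambda>x. e - f x)"
    by (rule ub) (use f b in \<open>fastforce intro!: continuous_intros simp: abs_le_iff\<close>)+
  moreover have "0 \<le> wint v (\<lambda>x. e + f x)"
    by (rule ub) (use f b in \<open>fastforce intro!: continuous_intros simp: abs_le_iff\<close>)+
  ultimately show ?thesis
    using wint_diff[OF v _ f, of "\<lambda>_. e"] wint_add[OF v _ f, of "\<lambda>_. e"] c by auto
qed

text \<open>
  Only \<open>v\<close> is merely integrable; the factor \<open>g\<close> is jointly continuous and \<open>{-1..1}\<close> is compact, so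
  \<open>g r\<close> is uniformly close to \<open>g s\<close> for \<open>r\<close> near \<open>s\<close>, which the integral turns into closeness.
\<close>
lemma continuous_on_wint:
  assumes v: "pos_weight v" and g: "continuous_on (U \<times> {-1..1}) (\<lambda>z. g (fst z) (snd z))"
  shows "continuous_on U (\<lambda>s::real. wint v (g s))"
  unfolding continuous_on_iff
proof (intro ballI allI impI)
  fix s and e :: real assume s: "s \<in> U" and e: "0 < e"
  have gc: "continuous_on {-1..1} (g s)" if "s \<in> U" for s
  proof -
    have "continuous_on {-1..1} ((\<lambda>z. g (fst z) (snd z)) \<circ> (\<lambda>x. (s, x)))"
      using that by (intro continuous_on_compose continuous_on_subset[OF g]) (auto intro!: continuous_intros)
    then show ?thesis by (simp add: o_def)
  qed
  define M where "M = wint v (\<lambda>_. 1)"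
  have M: "0 < M" unfolding M_def by (rule wint_pos[OF v]) auto
  obtain X where X: "s \<in> X" "open X"
    "\<forall>r\<in>X \<inter> U. \<forall>x\<in>{-1..1}. dist (g (fst (r, x)) (snd (r, x))) (g (fst (s, x)) (snd (s, x))) \<le> e / (2 * M)"
    using continuous_on_prod_compactE[OF g _ s, of "e / (2 * M)"] e M by auto
  obtain d where d: "d > 0" "ball s d \<subseteq> X" using X(1,2) open_contains_ball by blast
  show "\<exists>d>0. \<forall>r\<in>U. dist r s < d \<longrightarrow> dist (wint v (g r)) (wint v (g s)) < e"
  proof (intro exI conjI ballI impI)
    fix r assume r: "r \<in> U" "dist r s < d"
    then have "r \<in> X" using d by (auto simp: dist_commute)
    have "\<bar>wint v (\<lambda>x. g r x - g s x)\<bar> \<le> e / (2 * M) * M"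
      unfolding M_def
    proof (rule wint_abs_le[OF v])
      show "continuous_on {-1..1} (\<lambda>x. g r x - g s x)" using gc r s by (intro continuous_intros) auto
      show "\<bar>g r x - g s x\<bar> \<le> e / (2 * wint v (\<lambda>_. 1))" if "x \<in> {-1..1}" for x
        using X(3) r \<open>r \<in> X\<close> that by (auto simp: dist_real_def M_def)
    qed
    then show "dist (wint v (g r)) (wint v (g s)) < e"
      using M e wint_diff[OF v gc[OF r(1)] gc[OF s]] by (auto simp: dist_real_def)
  qed (use d in auto)
qed

section \<open>Orthogonal polynomials\<close>

text \<open>
  Polynomials of degree less than \<open>m\<close>, with the zero polynomial included also for \<open>m = 0\<close>, where
  \<open>degree q < m\<close> would exclude it. In this form the condition is closed under linear combinations.
\<close>
definition deg_less :: "nat \<Rightarrow> real poly \<Rightarrow> bool" where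
  "deg_less m q \<longleftrightarrow> q = 0 \<or> degree q < m"

lemma deg_less_coeff: "deg_less m q \<longleftrightarrow> (\<forall>i\<ge>m. coeff q i = 0)"
  unfolding deg_less_def
  by (metis coeff_0 coeff_eq_0 leading_coeff_0_iff le_less_trans linorder_not_le order_le_less_trans)

lemma deg_less_simps:
  "deg_less m 0" "deg_less m p \<Longrightarrow> deg_less m q \<Longrightarrow> deg_less m (p + q)" "deg_less m p \<Longrightarrow> deg_less m q \<Longrightarrow> deg_less m (p - q)"
  "deg_less m p \<Longrightarrow> deg_less m (smult c p)" "deg_less m p \<Longrightarrow> m \<le> k \<Longrightarrow> deg_less k p"
  by (auto simp: deg_less_coeff)

lemma continuous_on_poly_wint [continuous_intros]: "continuous_on A (poly (p :: real poly))"
  by (intro continuous_intros)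

lemma wint_poly_add: "pos_weight v \<Longrightarrow> wint v (poly (p + q)) = wint v (poly p) + wint v (poly q)"
  using wint_add[of v "poly p" "poly q"] by (simp add: continuous_on_poly_wint poly_add[abs_def])

lemma wint_poly_diff: "pos_weight v \<Longrightarrow> wint v (poly (p - q)) = wint v (poly p) - wint v (poly q)"
  using wint_diff[of v "poly p" "poly q"] by (simp add: continuous_on_poly_wint poly_diff[abs_def])

lemma wint_poly_smult: "wint v (poly (smult c p)) = c * wint v (poly p)"
  using wint_cmult[of v c "poly p"] by (simp add: poly_smult[abs_def])

lemma wint_poly_pos:
  assumes "pos_weight v" and "p \<noteq> 0" and "\<And>x. x \<in> {-1<..<1} \<Longrightarrow> 0 \<le> poly p x"
  shows "0 < wint v (poly p)"
proof (rule wint_pos[OF assms(1) continuous_on_poly_wint assms(3)])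
  show "finite {x \<in> {-1<..<1}. poly p x = 0}"
    using poly_roots_finite[OF assms(2)] by (rule finite_subset[rotated]) auto
qed auto

definition is_orth_poly :: "(real \<Rightarrow> real) \<Rightarrow> nat \<Rightarrow> real poly \<Rightarrow> bool" where
  "is_orth_poly v n p \<longleftrightarrow> degree p = n \<and> lead_coeff p = 1 \<and> (\<forall>q. deg_less n q \<longrightarrow> wint v (poly (p * q)) = 0)"

lemma is_orth_poly_nonzero: "is_orth_poly v n p \<Longrightarrow> p \<noteq> 0"
  by (auto simp: is_orth_poly_def)

lemma deg_less_Suc_split:
  assumes p: "degree p = m" "lead_coeff p = (1::real)" and q: "deg_less (Suc m) q"
  shows "deg_less m (q - smult (coeff q m) p)"
  unfolding deg_less_coeff
proof (intro allI impI)
  fix i assume "m \<le> i"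
  then consider "i = m" | "i > m" by linarith
  then show "coeff (q - smult (coeff q m) p) i = 0"
    by cases (use p q in \<open>auto simp: deg_less_coeff coeff_eq_0\<close>)
qed

lemma is_orth_poly_monom_minus_projection:
  assumes r: "deg_less n r" and o: "\<And>s. deg_less n s \<Longrightarrow> wint v (poly ((monom 1 n - r) * s)) = 0"
  shows "is_orth_poly v n (monom 1 n - r)"
proof -
  let ?p = "monom 1 n - r"
  have "coeff ?p n = 1" "\<forall>i>n. coeff ?p i = 0" using r by (auto simp: deg_less_coeff)
  moreover from this have "degree ?p = n" by (metis le_degree degree_le order_antisym zero_neq_one)
  ultimately show ?thesis using o by (simp add: is_orth_poly_def del: poly_mult)
qed

text \<open>
  Gram--Schmidt: the orthogonal polynomial of degree \<open>n\<close> is the monomial minus its projection onto lower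
  degrees, and the projection onto degrees up to \<open>n\<close> adds to the projection onto degrees below \<open>n\<close> the
  component along that orthogonal polynomial.
\<close>
lemma projection_exists:
  assumes v: "pos_weight v"
  shows "\<exists>q. deg_less n q \<and> (\<forall>s. deg_less n s \<longrightarrow> wint v (poly ((f - q) * s)) = 0)"
proof (induction n arbitrary: f)
  case 0
  then show ?case by (intro exI[of _ 0]) (auto simp: deg_less_def wint_def)
next
  case (Suc n)
  obtain r where r: "deg_less n r" "\<And>s. deg_less n s \<Longrightarrow> wint v (poly ((monom 1 n - r) * s)) = 0"
    using Suc by blast
  define p where "p = monom 1 n - r"
  have "is_orth_poly v n p" unfolding p_def by (rule is_orth_poly_monom_minus_projection[OF r])
  then have pc: "degree p = n" "lead_coeff p = 1" by (auto simp: is_orth_poly_def)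
  obtain q where q: "deg_less n q" "\<And>s. deg_less n s \<Longrightarrow> wint v (poly ((f - q) * s)) = 0"
    using Suc by blast
  have pp: "0 < wint v (poly (p * p))" using pc by (intro wint_poly_pos[OF v]) auto
  define a where "a = wint v (poly (f * p)) / wint v (poly (p * p))"
  have po: "wint v (poly (p * s)) = 0" if "deg_less n s" for s using r(2)[OF that] p_def by simp
  show ?case
  proof (intro exI[of _ "q + smult a p"] conjI allI impI)
    have "deg_less (Suc n) p" using pc by (simp add: deg_less_def)
    then show "deg_less (Suc n) (q + smult a p)" using deg_less_simps q(1) by (meson le_SucI order_refl)
    fix s assume s: "deg_less (Suc n) s"
    define c s' where "c = coeff s n" and "s' = s - smult c p"
    have s': "deg_less n s'" unfolding s'_def c_def by (rule deg_less_Suc_split[OF pc s])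
    have "(f - (q + smult a p)) * s =
      ((f - q) * s' - smult a (p * s')) + smult c ((f * p - p * q) - smult a (p * p))"
      by (simp add: s'_def algebra_simps smult_add_right smult_diff_right)
    then have "wint v (poly ((f - (q + smult a p)) * s)) = c * (wint v (poly (f * p)) - a * wint v (poly (p * p)))"
      using q(2)[OF s'] po[OF s'] po[OF q(1)]
      by (simp add: wint_poly_add[OF v] wint_poly_diff[OF v] wint_poly_smult)
    then show "wint v (poly ((f - (q + smult a p)) * s)) = 0" using pp by (simp add: a_def)
  qed
qed

lemma is_orth_poly_exists: "pos_weight v \<Longrightarrow> \<exists>p. is_orth_poly v n p"
  using projection_exists[of v n "monom 1 n"] is_orth_poly_monom_minus_projection by blast

text \<open>
  Subtracting the multiple of \<open>p\<close> that cancels the coefficient of degree \<open>n\<close> leaves a polynomial of degree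
  below \<open>n\<close> which is orthogonal to itself.
\<close>
lemma is_orth_poly_proportional:
  assumes v: "pos_weight v" and p: "is_orth_poly v n p" and q: "deg_less (Suc n) q"
    and o: "\<And>s. deg_less n s \<Longrightarrow> wint v (poly (q * s)) = 0"
  shows "q = smult (coeff q n) p"
proof -
  define d where "d = q - smult (coeff q n) p"
  have d: "deg_less n d" unfolding d_def using p q by (intro deg_less_Suc_split) (auto simp: is_orth_poly_def)
  have "d * d = q * d - smult (coeff q n) (p * d)" 
    by (metis d_def left_diff_distrib mult_smult_left)
  then have "wint v (poly (d * d)) = 0"
    using o[OF d] p d by (simp add: wint_poly_diff[OF v] wint_poly_smult is_orth_poly_def)
  moreover have "d \<noteq> 0 \<Longrightarrow> 0 < wint v (poly (d * d))" by (rule wint_poly_pos[OF v]) auto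
  ultimately show ?thesis using d_def by auto
qed

lemma is_orth_poly_unique:
  assumes v: "pos_weight v" and p: "is_orth_poly v n p" and q: "is_orth_poly v n q"
  shows "q = p"
proof -
  have "q = smult (coeff q n) p"
    using q by (intro is_orth_poly_proportional[OF v p]) (auto simp: is_orth_poly_def deg_less_def)
  moreover have "coeff q n = 1" using q by (auto simp: is_orth_poly_def)
  ultimately show ?thesis by simp
qed

definition orth_poly :: "(real \<Rightarrow> real) \<Rightarrow> nat \<Rightarrow> real poly" where
  "orth_poly v n = (THE p. is_orth_poly v n p)"

lemma is_orth_poly_orth_poly: "pos_weight v \<Longrightarrow> is_orth_poly v n (orth_poly v n)"
  unfolding orth_poly_def by (metis is_orth_poly_exists is_orth_poly_unique theI)

text \<open>
  If \<open>p = q * r\<close> with \<open>q\<close> non-constant and non-negative on the interval, then \<open>p\<close> would have to be orthogonal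
  to \<open>r\<close>, although \<open>p * r = q * r\<^sup>2\<close> has a positive integral. That the zeros of
  orthogonal polynomials are simple and lie in the interval rests on this argument.
\<close>
lemma orth_poly_factor_contra:
  assumes v: "pos_weight v" and p: "is_orth_poly v n p" "p = q * r" "0 < degree q"
    and sgn: "\<And>x. x \<in> {-1<..<1} \<Longrightarrow> 0 \<le> poly q x"
  shows False
proof -
  have nz: "q \<noteq> 0" "r \<noteq> 0" using is_orth_poly_nonzero[OF p(1)] p(2) by auto
  have "deg_less n r" using p nz by (auto simp: deg_less_def is_orth_poly_def degree_mult_eq)
  then have "wint v (poly (p * r)) = 0" using p(1) by (simp add: is_orth_poly_def)
  moreover have "0 < wint v (poly (p * r))"
    using nz sgn by (intro wint_poly_pos[OF v]) (auto simp: p(2) mult.assoc)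
  ultimately show False by simp
qed

lemma prod_linear_dvd:
  fixes p :: "real poly"
  assumes "finite A" and "\<And>z. z \<in> A \<Longrightarrow> poly p z = 0"
  shows "(\<Prod>z\<in>A. [:-z, 1:]) dvd p"
  using assms
proof (induction A rule: finite_induct)
  case (insert a A)
  then obtain r where r: "p = (\<Prod>z\<in>A. [:-z, 1:]) * r" by (metis dvdE insertCI)
  have "poly (\<Prod>z\<in>A. [:-z, 1:]) a \<noteq> 0" using insert by (auto simp: poly_prod)
  then have "poly r a = 0" using insert.prems[of a] r by simp
  then have "[:-a, 1:] dvd r" by (simp add: poly_eq_0_iff_dvd)
  then show ?case using insert r by (metis mult.commute mult_dvd_mono dvd_refl prod.insert)
qed auto

lemma degree_prod_linear: "degree (\<Prod>z\<in>A. [:-z, 1::real:]) = card A"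
  by (subst degree_prod_eq_sum_degree) auto

definition zeros :: "(real \<Rightarrow> real) \<Rightarrow> nat \<Rightarrow> real set" where
  "zeros v n = {x \<in> {-1<..<1}. poly (orth_poly v n) x = 0}"

text \<open>
  A double zero \<open>x\<close> gives the non-negative factor \<open>(X - x)\<^sup>2\<close>. Once the zeros are known to be simple,
  dividing by all linear factors with a zero in the interval leaves a factor without zeros there; it has constant
  sign by the intermediate value theorem, hence must be constant.
\<close>
lemma orth_poly_factorization:
  assumes v: "pos_weight v"
  shows "finite (zeros v n)" "card (zeros v n) = n" "orth_poly v n = (\<Prod>z\<in>zeros v n. [:-z, 1:])"
proof -
  define p Z where "p = orth_poly v n" and "Z = zeros v n"
  have p: "is_orth_poly v n p" unfolding p_def by (rule is_orth_poly_orth_poly[OF v])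
  have Z: "Z = {x \<in> {-1<..<1}. poly p x = 0}" by (simp add: Z_def zeros_def p_def)
  have p0: "p \<noteq> 0" using is_orth_poly_nonzero[OF p] .
  have fin: "finite Z" unfolding Z using poly_roots_finite[OF p0] by (rule finite_subset[rotated]) auto
  define q where "q = (\<Prod>z\<in>Z. [:-z, 1:])"
  have qroot: "poly q x = 0 \<longleftrightarrow> x \<in> Z" for x
    using fin by (auto simp: q_def poly_prod)
  have "q dvd p"
    unfolding q_def by (rule prod_linear_dvd[OF fin]) (simp add: Z)
  then obtain r where r: "p = q * r" by blast
  have rnz: "poly r x \<noteq> 0" if x: "x \<in> {-1<..<1}" for x
  proof
    assume rx: "poly r x = 0"
    then have "x \<in> Z" using x by (simp add: Z r)
    then have "[:-x, 1:] dvd q" by (simp add: qroot poly_eq_0_iff_dvd[symmetric])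
    moreover have "[:-x, 1:] dvd r" using rx by (simp add: poly_eq_0_iff_dvd[symmetric])
    ultimately have "[:-x, 1:] * [:-x, 1:] dvd p" using r mult_dvd_mono by blast
    then obtain s where s: "p = ([:-x, 1:] * [:-x, 1:]) * s" by blast
    show False
    proof (rule orth_poly_factor_contra[OF v p s])
      show "0 < degree ([:- x, 1:] * [:- x, 1:])" by (subst degree_mult_eq) auto
      show "0 \<le> poly ([:- x, 1:] * [:- x, 1:]) y" for y
        unfolding poly_mult by (rule zero_le_square)
    qed
  qed
  have "degree r = 0"
  proof (rule ccontr)
    assume d: "degree r \<noteq> 0"
    show False
    proof (cases "\<forall>x\<in>{-1<..<1}. 0 \<le> poly r x")
      case True
      with d show False using orth_poly_factor_contra[OF v p, of r q] r by (auto simp: mult.commute)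
    next
      case False
      then obtain a where a: "a \<in> {-1<..<1}" "poly r a < 0" by force
      have "poly r b \<le> 0" if b: "b \<in> {-1<..<1}" for b
      proof (rule ccontr)
        assume "\<not> poly r b \<le> 0"
        then have rb: "poly r b > 0" by simp
        then consider "a < b" | "b < a" using a by fastforce
        then have "\<exists>x\<in>{-1<..<1}. poly r x = 0"
        proof cases
          case 1
          then show ?thesis using poly_IVT_pos[OF 1 a(2) rb] a b by force
        next
          case 2
          then show ?thesis using poly_IVT_neg[OF 2 rb a(2)] a b by force
        qed
        then show False using rnz by blast
      qed
      then show False using orth_poly_factor_contra[OF v p, of "-r" "-q"] r d by (auto simp: mult.commute)
    qed
  qed
  then obtain c where c: "r = [:c:]" using degree_eq_zeroE by blast
  have "lead_coeff q = 1" unfolding q_def by (simp add: lead_coeff_prod)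
  then have "c = 1" using p lead_coeff_mult[of q r] unfolding is_orth_poly_def r by (metis c lead_coeff_pCons(2) mult_1)
  then have pq: "p = q" using r c by simp
  have "card Z = n"
    using p pq degree_prod_linear[of Z] by (simp add: is_orth_poly_def q_def)
  then show "finite (zeros v n)" "card (zeros v n) = n" "orth_poly v n = (\<Prod>z\<in>zeros v n. [:-z, 1:])"
    using fin pq by (simp_all add: Z_def p_def q_def)
qed

lemma poly_orth_poly_eq_0_iff: "pos_weight v \<Longrightarrow> poly (orth_poly v n) x = 0 \<longleftrightarrow> x \<in> zeros v n"
  using orth_poly_factorization[of v n] by (auto simp: poly_prod)

lemma zeros_subset: "zeros v n \<subseteq> {-1<..<1}"
  by (auto simp: zeros_def)

definition cofactor :: "(real \<Rightarrow> real) \<Rightarrow> nat \<Rightarrow> real \<Rightarrow> real poly" where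
  "cofactor v n z = (\<Prod>y\<in>zeros v n - {z}. [:-y, 1:])"

lemma cofactor:
  assumes v: "pos_weight v" and z: "z \<in> zeros v n"
  shows "orth_poly v n = [:-z, 1:] * cofactor v n z" "degree (cofactor v n z) = n - 1"
    "poly (cofactor v n z) z \<noteq> 0" "\<And>y. y \<in> zeros v n \<Longrightarrow> y \<noteq> z \<Longrightarrow> poly (cofactor v n z) y = 0"
proof -
  note F = orth_poly_factorization[OF v, of n]
  show "orth_poly v n = [:-z, 1:] * cofactor v n z"
    unfolding F(3) cofactor_def by (rule prod.remove[OF F(1) z])
  show "degree (cofactor v n z) = n - 1" using F z by (simp add: cofactor_def degree_prod_linear)
  show "poly (cofactor v n z) z \<noteq> 0" using F(1) by (auto simp: cofactor_def poly_prod)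
  show "poly (cofactor v n z) y = 0" if "y \<in> zeros v n" "y \<noteq> z" for y
    using that F(1) by (auto simp: cofactor_def poly_prod)
qed

lemma pderiv_orth_poly_zero:
  assumes v: "pos_weight v" and z: "z \<in> zeros v n"
  shows "poly (pderiv (orth_poly v n)) z = poly (cofactor v n z) z"
proof -
  have "pderiv (orth_poly v n) = [:-z, 1:] * pderiv (cofactor v n z) + cofactor v n z * pderiv [:-z, 1:]"
    unfolding cofactor(1)[OF v z] by (rule pderiv_mult)
  then show ?thesis by (simp add: pderiv_pCons)
qed

definition christoffel :: "(real \<Rightarrow> real) \<Rightarrow> nat \<Rightarrow> real \<Rightarrow> real" where
  "christoffel v n z = wint v (poly ((cofactor v n z)\<^sup>2)) / (poly (cofactor v n z) z)\<^sup>2"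

lemma christoffel_pos:
  assumes v: "pos_weight v" and z: "z \<in> zeros v n"
  shows "0 < christoffel v n z"
  unfolding christoffel_def using cofactor(3)[OF v z]
  by (intro divide_pos_pos wint_poly_pos[OF v]) auto

lemma wint_poly_sum:
  assumes "pos_weight v" "finite A"
  shows "wint v (poly (\<Sum>i\<in>A. f i)) = (\<Sum>i\<in>A. wint v (poly (f i)))"
  using wint_sum[OF assms, of "\<lambda>i. poly (f i)"]
  by (simp add: continuous_on_poly_wint poly_sum[abs_def])

text \<open>
  The squares of the cofactors already interpolate at the zeros: each vanishes at all zeros but its own. Subtracting the
  combination \<open>h\<close> of them that agrees with \<open>f\<close> at the zeros leaves a multiple \<open>p * s\<close> of the orthogonal
  polynomial \<open>p\<close> with \<open>s\<close> of degree below \<open>n\<close>, whose integral is zero.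
\<close>
lemma gauss_quadrature:
  assumes v: "pos_weight v" and f: "deg_less (2 * n) f"
  shows "wint v (poly f) = (\<Sum>z\<in>zeros v n. christoffel v n z * poly f z)"
proof -
  note F = orth_poly_factorization[OF v, of n]
  let ?l = "cofactor v n" and ?Z = "zeros v n"
  define h where "h = (\<Sum>z\<in>?Z. smult (poly f z / (poly (?l z) z)\<^sup>2) ((?l z)\<^sup>2))"
  define g where "g = f - h"
  have "deg_less (2 * n) h"
    unfolding deg_less_coeff
  proof (intro allI impI)
    fix i assume i: "2 * n \<le> i"
    have "coeff ((?l z)\<^sup>2) i = 0" if z: "z \<in> ?Z" for z
    proof (rule coeff_eq_0)
      have "n > 0" using F z by (metis card_gt_0_iff empty_iff)
      moreover have "degree ((?l z)\<^sup>2) \<le> (n - 1) * 2"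
        using degree_power_le[of "?l z" 2] cofactor(2)[OF v z] by simp
      ultimately show "degree ((?l z)\<^sup>2) < i" using i by linarith
    qed
    then show "coeff h i = 0" by (simp add: h_def coeff_sum)
  qed
  then have gb: "deg_less (2 * n) g" unfolding g_def using f by (rule deg_less_simps(3)[rotated])
  have "poly g y = 0" if y: "y \<in> ?Z" for y
  proof -
    have "poly h y = (\<Sum>z\<in>?Z. if z = y then poly f y else 0)"
      unfolding h_def poly_sum
      using cofactor(3,4)[OF v] y by (intro sum.cong) auto
    then show ?thesis using F(1) y by (simp add: g_def)
  qed
  then have "orth_poly v n dvd g" using prod_linear_dvd[OF F(1), of g] F(3) by simp
  then obtain s where s: "g = orth_poly v n * s" by blast
  have orth_poly: "is_orth_poly v n (orth_poly v n)" by (rule is_orth_poly_orth_poly[OF v])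
  have "deg_less n s"
  proof (cases "s = 0")
    case False
    moreover have "orth_poly v n \<noteq> 0" using is_orth_poly_nonzero[OF orth_poly] .
    ultimately have "degree (orth_poly v n) + degree s < 2 * n"
      using gb s by (simp add: deg_less_def degree_mult_eq)
    then show ?thesis using orth_poly by (simp add: deg_less_def is_orth_poly_def)
  qed (simp add: deg_less_def)
  then have "wint v (poly g) = 0" using orth_poly unfolding s is_orth_poly_def by simp
  then have "wint v (poly f) = wint v (poly h)" by (simp add: g_def wint_poly_diff[OF v])
  also have "\<dots> = (\<Sum>z\<in>?Z. christoffel v n z * poly f z)"
    unfolding h_def wint_poly_sum[OF v F(1)] wint_poly_smult christoffel_def
    by (intro sum.cong) auto
  finally show ?thesis .
qed

section \<open>Dependence of the orthogonal polynomial on the parameter\<close>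

lemma one_plus_pos:
  fixes t x :: real
  assumes "t \<in> {-1<..<1}" "x \<in> {-1..1}"
  shows "0 < 1 + t * x"
proof -
  have "\<bar>t * x\<bar> < 1"
    unfolding abs_mult using assms mult_left_le[of "\<bar>x\<bar>" "\<bar>t\<bar>"] by (auto simp: abs_le_iff abs_less_iff)
  then show ?thesis by auto
qed

lemma rker_pos: "t \<in> {-1<..<1} \<Longrightarrow> x \<in> {-1..1} \<Longrightarrow> 0 < rker t x"
  by (simp add: rker_def one_plus_pos)

lemma continuous_on_rker: "t \<in> {-1<..<1} \<Longrightarrow> continuous_on {-1..1} (rker t)"
  unfolding rker_def by (intro continuous_intros ballI) (use one_plus_pos in force)

definition tilt :: "(real \<Rightarrow> real) \<Rightarrow> real \<Rightarrow> real \<Rightarrow> real" where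
  "tilt v t = (\<lambda>x. rker t x * v x)"

lemma pos_weight_tilt: "pos_weight v \<Longrightarrow> t \<in> {-1<..<1} \<Longrightarrow> pos_weight (tilt v t)"
  unfolding tilt_def by (intro pos_weight_mult continuous_on_rker rker_pos)

text \<open>
  Division with remainder by \<open>1 + t X\<close>, with the remainder a multiple of a prescribed \<open>l\<close> instead of a constant.
  This is possible when \<open>l\<close> does not vanish at the zero \<open>-1/t\<close> of the divisor. For \<open>t = 0\<close> that zero lies at
  infinity, and the evaluation there of a polynomial of formal degree \<open>m\<close> is its coefficient of degree \<open>m\<close>.
\<close>
lemma division_by_kernel:
  fixes q l :: "real poly"
  assumes q: "deg_less (Suc m) q" and l: "deg_less (Suc m) l"
    and l0: "t = 0 \<Longrightarrow> coeff l m \<noteq> 0" and l1: "t \<noteq> 0 \<Longrightarrow> poly l (- 1 / t) \<noteq> 0"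
  shows "\<exists>C Q. q = smult C l + [:1, t:] * Q \<and> deg_less m Q"
proof (cases "t = 0")
  case True
  define C where "C = coeff q m / coeff l m"
  have "deg_less m (q - smult C l)"
    unfolding deg_less_coeff
  proof (intro allI impI)
    fix i assume "m \<le> i"
    then consider "i = m" | "i \<ge> Suc m" by linarith
    then show "coeff (q - smult C l) i = 0"
      by cases (use q l l0[OF True] in \<open>auto simp: deg_less_coeff C_def\<close>)
  qed
  then show ?thesis using True by (intro exI[of _ C] exI[of _ "q - smult C l"]) simp
next
  case False
  define C where "C = poly q (-1/t) / poly l (-1/t)"
  define r where "r = q - smult C l"
  have "poly r (-1/t) = 0" using l1[OF False] by (simp add: r_def C_def)
  then obtain s where s: "r = [:- (-1/t), 1:] * s" unfolding poly_eq_0_iff_dvd by blast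
  define Q where "Q = smult (1/t) s"
  have Q: "r = [:1, t:] * Q" 
  proof -
    have "[:- (-1/t), 1:] = smult (1/t) [:1, t:]" using False by simp
    then show ?thesis unfolding s Q_def by (metis mult_smult_left mult_smult_right)
  qed
  have "deg_less (Suc m) r" unfolding r_def using q l deg_less_simps by blast
  then have "deg_less m Q"
    unfolding Q deg_less_def using False by (cases "Q = 0") (auto simp: degree_mult_eq simp del: mult_pCons_left)
  moreover have "q = smult C l + [:1, t:] * Q" using Q r_def by simp
  ultimately show ?thesis by blast
qed

lemma continuous_on_rker_pair: "continuous_on ({-1<..<1} \<times> {-1..1}) (\<lambda>z. rker (fst z) (snd z))"
  unfolding rker_def by (intro continuous_intros ballI) (use one_plus_pos in force)

lemma continuous_on_snd_pair: "continuous_on C f \<Longrightarrow> continuous_on (U \<times> C) (\<lambda>z. f (snd z))"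
  by (rule continuous_on_compose2[of C f]) (auto intro!: continuous_intros)

lemma continuous_on_wint_rker_deriv:
  assumes v: "pos_weight v" and f: "continuous_on {-1..1} f"
  shows "continuous_on {-1<..<1} (\<lambda>t. wint v (\<lambda>x. - (x * f x * rker t x * rker t x)))"
  by (rule continuous_on_wint[OF v])
    (intro continuous_intros continuous_on_rker_pair continuous_on_snd_pair f)

text \<open>
  The difference quotient of the kernel is explicit, \<open>(rker s x - rker t x) / (s - t) = - x rker s x rker t x\<close>.
  So the difference quotient of the integral is again an integral depending continuously on \<open>s\<close>.
\<close>
lemma wint_rker_deriv:
  assumes v: "pos_weight v" and f: "continuous_on {-1..1} f" and t: "t \<in> {-1<..<1}"
  shows "((\<lambda>t. wint v (\<lambda>x. f x * rker t x)) has_real_derivative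
           wint v (\<lambda>x. - (x * f x * rker t x * rker t x))) (at t)"
proof -
  define H where "H = (\<lambda>s. wint v (\<lambda>x. - (x * f x * rker s x * rker t x)))"
  have "continuous_on {-1<..<1} H"
    unfolding H_def by (rule continuous_on_wint[OF v])
      (intro continuous_intros continuous_on_rker_pair continuous_on_snd_pair f continuous_on_rker t)
  then have "(H \<longlongrightarrow> H t) (at t)" using t by (simp add: continuous_on_eq_continuous_at isCont_def)
  moreover have "eventually (\<lambda>s. H s = (wint v (\<lambda>x. f x * rker s x) - wint v (\<lambda>x. f x * rker t x)) / (s - t)) (at t)"
    using eventually_at_in_open[OF _ t]
  proof (rule eventually_mono)
    show "open {-1<..<1::real}" by simp
    fix s assume "s \<in> {-1<..<1} - {t}"
    then have s: "s \<in> {-1<..<1}" "s \<noteq> t" by auto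
    have "wint v (\<lambda>x. f x * rker s x) - wint v (\<lambda>x. f x * rker t x)
        = wint v (\<lambda>x. f x * rker s x - f x * rker t x)"
      using s t by (intro wint_diff[OF v, symmetric] continuous_intros f continuous_on_rker)
    also have "\<dots> = wint v (\<lambda>x. (s - t) * - (x * f x * rker s x * rker t x))"
    proof (rule wint_cong)
      fix x :: real assume x: "x \<in> {-1..1}"
      have "1 + s * x > 0" "1 + t * x > 0" using s t x one_plus_pos by blast+
      then have "rker s x - rker t x = (s - t) * - (x * rker s x * rker t x)"
        by (simp add: rker_def divide_simps) (simp add: algebra_simps)
      then have "f x * rker s x - f x * rker t x = f x * ((s - t) * - (x * rker s x * rker t x))"
        by (metis right_diff_distrib)
      also have "\<dots> = (s - t) * - (x * f x * rker s x * rker t x)"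
        by simp
      finally show "(f x * rker s x - f x * rker t x) * v x
          = (s - t) * - (x * f x * rker s x * rker t x) * v x" by (rule arg_cong)
    qed
    also have "\<dots> = (s - t) * H s" unfolding H_def by (rule wint_cmult)
    finally show "H s = (wint v (\<lambda>x. f x * rker s x) - wint v (\<lambda>x. f x * rker t x)) / (s - t)"
      using s by simp
  qed
  ultimately have "((\<lambda>t. wint v (\<lambda>x. f x * rker t x)) has_real_derivative H t) (at t)"
    unfolding has_field_derivative_iff by (rule Lim_transform_eventually)
  then show ?thesis by (simp add: H_def)
qed

lemma wint_tilt: "wint (tilt v t) f = wint v (\<lambda>x. f x * rker t x)"
  unfolding tilt_def by (rule wint_mult_weight)

lemma wint_tilt_mult:
  assumes "t \<in> {-1<..<1}"
  shows "wint (tilt v t) (poly ([:1, t:] * q)) = wint v (poly q)"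
  unfolding tilt_def
proof (rule wint_cong)
  fix x :: real assume x: "x \<in> {-1..1}"
  show "poly ([:1, t:] * q) x * (rker t x * v x) = poly q x * v x"
  proof -
    have "(1 + t * x) * rker t x = 1" using one_plus_pos[OF assms x] by (simp add: rker_def)
    moreover have "poly ([:1, t:] * q) x = poly q x * (1 + t * x)" by (simp add: algebra_simps)
    ultimately show ?thesis by (metis mult.assoc mult_1)
  qed
qed

text \<open>
  Since the tilted weight times \<open>1 + t X\<close> is the original weight, the tilted polynomial of degree \<open>n\<close> is orthogonal
  for \<open>v\<close> to all degrees below \<open>n - 1\<close>. Hence it moves on the line through the fixed polynomial \<open>P\<close> of
  degree \<open>n\<close> in the direction of \<open>R\<close>, the one of degree \<open>n - 1\<close>. One remaining orthogonality condition, against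
  \<open>X^(n-1)\<close>, determines the position on this line as \<open>a t = - A t / B t\<close>. The denominator cannot vanish:
  otherwise \<open>R\<close> would be orthogonal to itself for the tilted weight. So \<open>a\<close> inherits continuous
  differentiability from the integrals \<open>A\<close> and \<open>B\<close>.
\<close>
lemma orth_poly_tilt:
  assumes v: "pos_weight v" and n: "1 \<le> n"
  shows "\<exists>a D. continuous_on {-1<..<1} D \<and>
    (\<forall>t\<in>{-1<..<1}. (a has_real_derivative D t) (at t) \<and>
       orth_poly (tilt v t) n = orth_poly v n + smult (a t) (orth_poly v (n - 1)))"
proof -
  define P R where "P = orth_poly v n" and "R = orth_poly v (n - 1)"
  define X where "X = (monom 1 (n - 1) :: real poly)"
  define A B where "A = (\<lambda>t. wint v (\<lambda>x. poly (P * X) x * rker t x))"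
    and "B = (\<lambda>t. wint v (\<lambda>x. poly (R * X) x * rker t x))"
  have P: "is_orth_poly v n P" and R: "is_orth_poly v (n - 1) R"
    unfolding P_def R_def by (rule is_orth_poly_orth_poly[OF v])+
  have X: "deg_less n X" using n by (auto simp: X_def deg_less_coeff)
  have Xl: "deg_less (Suc (n - 1)) X" "t = 0 \<Longrightarrow> coeff X (n - 1) \<noteq> 0" "t \<noteq> 0 \<Longrightarrow> poly X (- 1 / t) \<noteq> 0" for t
    using X n by (auto simp: X_def poly_monom)
  have Rb: "deg_less (Suc (n - 1)) R" using R by (auto simp: is_orth_poly_def deg_less_def)
  have AB: "A t = wint (tilt v t) (poly (P * X))" "B t = wint (tilt v t) (poly (R * X))" for t
    by (simp_all only: A_def B_def wint_tilt)
  have Bnz: "B t \<noteq> 0" if t: "t \<in> {-1<..<1}" for t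
  proof
    assume B0: "B t = 0"
    note vt = pos_weight_tilt[OF v t]
    obtain C Q where CQ: "R = smult C X + [:1, t:] * Q" "deg_less (n - 1) Q"
      using division_by_kernel[OF Rb Xl] by blast
    have "R * R = smult C (R * X) + [:1, t:] * (R * Q)"
      by (subst (2) CQ(1)) (simp add: algebra_simps)
    then have "wint (tilt v t) (poly (R * R)) = C * B t + wint v (poly (R * Q))"
      by (simp only: wint_poly_add[OF vt] wint_poly_smult wint_tilt_mult[OF t] AB)
    also have "\<dots> = 0" using B0 R CQ(2) by (simp add: is_orth_poly_def)
    finally have "wint (tilt v t) (poly (R * R)) = 0" .
    moreover have "0 < wint (tilt v t) (poly (R * R))"
      using is_orth_poly_nonzero[OF R] by (intro wint_poly_pos[OF vt]) auto
    ultimately show False by simp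
  qed
  define DA where "DA = (\<lambda>t. wint v (\<lambda>x. - (x * poly (P * X) x * rker t x * rker t x)))"
  have DA: "continuous_on {-1<..<1} DA" "\<And>t. t \<in> {-1<..<1} \<Longrightarrow> (A has_real_derivative DA t) (at t)"
    unfolding DA_def A_def
    by (rule continuous_on_wint_rker_deriv[OF v continuous_on_poly_wint] wint_rker_deriv[OF v continuous_on_poly_wint], assumption?)+
  define DB where "DB = (\<lambda>t. wint v (\<lambda>x. - (x * poly (R * X) x * rker t x * rker t x)))"
  have DB: "continuous_on {-1<..<1} DB" "\<And>t. t \<in> {-1<..<1} \<Longrightarrow> (B has_real_derivative DB t) (at t)"
    unfolding DB_def B_def
    by (rule continuous_on_wint_rker_deriv[OF v continuous_on_poly_wint] wint_rker_deriv[OF v continuous_on_poly_wint], assumption?)+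
  define a where "a = (\<lambda>t. - (A t / B t))"
  define D where "D = (\<lambda>t. - ((DA t * B t - A t * DB t) / (B t * B t)))"
  have "continuous_on {-1<..<1} A" "continuous_on {-1<..<1} B"
    using DA(2) DB(2) by (meson DERIV_isCont continuous_at_imp_continuous_on)+
  then have Dc: "continuous_on {-1<..<1} D"
    unfolding D_def using Bnz by (intro continuous_intros DA(1) DB(1)) auto
  have "(a has_real_derivative D t) (at t)" if t: "t \<in> {-1<..<1}" for t
    unfolding a_def D_def using DA(2)[OF t] DB(2)[OF t] Bnz[OF t]
    by (intro DERIV_minus DERIV_divide)
  moreover have "orth_poly (tilt v t) n = P + smult (a t) R" if t: "t \<in> {-1<..<1}" for t
  proof -
    note vt = pos_weight_tilt[OF v t]
    define p where "p = orth_poly (tilt v t) n"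
    have p: "is_orth_poly (tilt v t) n p" unfolding p_def by (rule is_orth_poly_orth_poly[OF vt])
    have "deg_less n (p - P)"
      using P p deg_less_Suc_split[of P n p] by (auto simp: is_orth_poly_def deg_less_def)
    then have db: "deg_less (Suc (n - 1)) (p - P)" using n by simp
    have "p - P = smult (coeff (p - P) (n - 1)) R"
    proof (rule is_orth_poly_proportional[OF v R db])
      fix s :: "real poly" assume s: "deg_less (n - 1) s"
      have "deg_less n ([:1, t:] * s)"
        unfolding deg_less_coeff using s by (auto simp: deg_less_coeff coeff_pCons split: nat.splits)
      then have "wint (tilt v t) (poly (p * ([:1, t:] * s))) = 0"
        using p unfolding is_orth_poly_def by blast
      moreover have "p * ([:1, t:] * s) = [:1, t:] * (p * s)" by (rule mult.left_commute)
      ultimately have "wint v (poly (p * s)) = 0" by (metis wint_tilt_mult[OF t])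
      moreover have "wint v (poly (P * s)) = 0"
        using P s deg_less_simps(5)[of "n - 1" s n] by (auto simp: is_orth_poly_def)
      ultimately show "wint v (poly ((p - P) * s)) = 0"
        by (simp add: left_diff_distrib wint_poly_diff[OF v])
    qed
    then obtain c where c: "p = P + smult c R" by (metis add.commute diff_add_cancel)
    have "wint (tilt v t) (poly (p * X)) = 0" using p X by (auto simp: is_orth_poly_def)
    moreover have "p * X = P * X + smult c (R * X)" by (simp add: c algebra_simps)
    ultimately have "A t + c * B t = 0"
      by (simp add: wint_poly_add[OF vt] wint_poly_smult AB)
    then have "c = a t" using Bnz[OF t] by (simp add: a_def field_simps)
    then show ?thesis using c p_def by simp
  qed
  ultimately show ?thesis using Dc unfolding P_def R_def by blast
qed

section \<open>Motion of the ordered zeros\<close>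

lemma sorted_list_of_set_image_strict_mono:
  fixes f :: "'a::linorder \<Rightarrow> 'b::linorder"
  assumes "finite A" "strict_mono_on A f"
  shows "sorted_list_of_set (f ` A) = map f (sorted_list_of_set A)"
proof (rule sorted_distinct_set_unique)
  let ?xs = "sorted_list_of_set A"
  have set: "set ?xs = A" using assms by simp
  show "sorted (map f ?xs)"
    unfolding sorted_map
    by (rule sorted_wrt_mono_rel[OF _ sorted_sorted_list_of_set])
      (use assms(2) in \<open>force simp: set strict_mono_on_def order.order_iff_strict\<close>)
  show "distinct (map f ?xs)"
    using assms strict_mono_on_imp_inj_on by (auto simp: distinct_map)
qed (use assms in auto)

lemma sign_change_at_simple_zero:
  fixes q :: "real poly"
  assumes "poly q z = 0" "poly (pderiv q) z \<noteq> 0"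
  shows "eventually (\<lambda>d. poly q (z - d) * poly q (z + d) < 0) (at_right 0)"
proof -
  have der: "DERIV (poly q) z :> poly (pderiv q) z" by (rule poly_DERIV)
  obtain d where "d > 0" "\<And>h. 0 < h \<Longrightarrow> h < d \<Longrightarrow> poly q (z - h) * poly q (z + h) < 0"
  proof (cases "poly (pderiv q) z > 0")
    case True
    obtain d1 d2 where d: "d1 > 0" "d2 > 0" "\<And>h. 0 < h \<Longrightarrow> h < d1 \<Longrightarrow> 0 < poly q (z + h)"
      "\<And>h. 0 < h \<Longrightarrow> h < d2 \<Longrightarrow> poly q (z - h) < 0"
      using DERIV_pos_inc_right[OF der True] DERIV_pos_inc_left[OF der True] assms(1) by auto
    show ?thesis by (rule that[of "min d1 d2"]) (use d in \<open>auto intro: mult_neg_pos\<close>)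
  next
    case False
    then have neg: "poly (pderiv q) z < 0" using assms by simp
    obtain d1 d2 where d: "d1 > 0" "d2 > 0" "\<And>h. 0 < h \<Longrightarrow> h < d1 \<Longrightarrow> poly q (z + h) < 0"
      "\<And>h. 0 < h \<Longrightarrow> h < d2 \<Longrightarrow> 0 < poly q (z - h)"
      using DERIV_neg_dec_right[OF der neg] DERIV_neg_dec_left[OF der neg] assms(1) by auto
    show ?thesis by (rule that[of "min d1 d2"]) (use d in \<open>auto intro: mult_pos_neg\<close>)
  qed
  then show ?thesis unfolding eventually_at_right_field by auto
qed

text \<open>
  Around each simple zero the polynomial changes sign across a short interval, and it keeps doing so for nearby parameters.
  The intervals are disjoint, so they catch as many zeros as there are, and in the same order.
\<close>
lemma simple_zeros_perturbation:
  fixes p :: "real \<Rightarrow> real poly" and Z :: "real \<Rightarrow> real set"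
  assumes U: "open U" "t0 \<in> U" 
    and Z: "\<And>t. t \<in> U \<Longrightarrow> finite (Z t) \<and> card (Z t) = n" "\<And>t x. t \<in> U \<Longrightarrow> poly (p t) x = 0 \<longleftrightarrow> x \<in> Z t"
    and simple: "\<And>z. z \<in> Z t0 \<Longrightarrow> poly (pderiv (p t0)) z \<noteq> 0"
    and cont: "\<And>x. isCont (\<lambda>t. poly (p t) x) t0" and e: "0 < e"
  shows "eventually (\<lambda>t. \<exists>f. strict_mono_on (Z t0) f \<and> Z t = f ` Z t0 \<and> (\<forall>z\<in>Z t0. \<bar>f z - z\<bar> < e)) (at t0)"
proof -
  have fin: "finite (Z t0)" using Z U by blast
  have "eventually (\<lambda>d. \<forall>z\<in>Z t0. poly (p t0) (z - d) * poly (p t0) (z + d) < 0) (at_right 0)"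
    using Z(2)[OF U(2)] simple by (intro eventually_ball_finite fin ballI sign_change_at_simple_zero) auto
  moreover have "eventually (\<lambda>d. \<forall>z\<in>Z t0. \<forall>y\<in>Z t0. z < y \<longrightarrow> z + d < y - d) (at_right 0)"
  proof (intro eventually_ball_finite fin ballI)
    fix z y :: real
    show "eventually (\<lambda>d. z < y \<longrightarrow> z + d < y - d) (at_right 0)"
    proof (cases "z < y")
      case True
      then show ?thesis
        unfolding eventually_at_right_field by (intro exI[of _ "(y - z) / 2"]) (auto simp: field_simps)
    qed simp
  qed
  moreover have "eventually (\<lambda>d. 0 < d \<and> d < e) (at_right 0)"
    using e unfolding eventually_at_right_field by (auto intro!: exI[of _ e])
  ultimately have "eventually (\<lambda>d. (\<forall>z\<in>Z t0. poly (p t0) (z - d) * poly (p t0) (z + d) < 0) \<and>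
      (\<forall>z\<in>Z t0. \<forall>y\<in>Z t0. z < y \<longrightarrow> z + d < y - d) \<and> 0 < d \<and> d < e) (at_right 0)"
    by eventually_elim auto
  then obtain d where d: "\<And>z. z \<in> Z t0 \<Longrightarrow> poly (p t0) (z - d) * poly (p t0) (z + d) < 0"
      "\<And>z y. z \<in> Z t0 \<Longrightarrow> y \<in> Z t0 \<Longrightarrow> z < y \<Longrightarrow> z + d < y - d" "0 < d" "d < e"
    using eventually_happens'[OF trivial_limit_at_right_real] by blast
  have "eventually (\<lambda>t. \<forall>z\<in>Z t0. poly (p t) (z - d) * poly (p t) (z + d) < 0) (at t0)"
  proof (intro eventually_ball_finite fin ballI)
    fix z assume z: "z \<in> Z t0"
    have "isCont (\<lambda>t. poly (p t) (z - d) * poly (p t) (z + d)) t0"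
      using cont by (intro continuous_intros)
    then show "eventually (\<lambda>t. poly (p t) (z - d) * poly (p t) (z + d) < 0) (at t0)"
      unfolding isCont_def using d(1)[OF z] by (rule order_tendstoD(2))
  qed
  moreover have "eventually (\<lambda>t. t \<in> U) (at t0)"
    using eventually_at_in_open'[OF U] .
  ultimately show ?thesis
  proof eventually_elim
    fix t assume sg: "\<forall>z\<in>Z t0. poly (p t) (z - d) * poly (p t) (z + d) < 0" and t: "t \<in> U"
    have "\<exists>y. z - d < y \<and> y < z + d \<and> poly (p t) y = 0" if z: "z \<in> Z t0" for z
    proof -
      have lt: "z - d < z + d" using d(3) by simp
      have "poly (p t) (z - d) * poly (p t) (z + d) < 0" using sg z by blast
      then show ?thesis
        using poly_IVT_pos[OF lt, of "p t"] poly_IVT_neg[OF lt, of "p t"]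
        unfolding mult_less_0_iff by blast
    qed
    then obtain f where f: "\<And>z. z \<in> Z t0 \<Longrightarrow> z - d < f z \<and> f z < z + d \<and> poly (p t) (f z) = 0"
      by metis
    have mono: "strict_mono_on (Z t0) f"
    proof (rule strict_mono_onI)
      fix y z assume "y \<in> Z t0" "z \<in> Z t0" "y < z"
      then show "f y < f z" using f[of y] f[of z] d(2)[of y z] by linarith
    qed
    have sub: "f ` Z t0 \<subseteq> Z t" using f Z(2)[OF t] by auto
    have "card (f ` Z t0) = n"
      using Z(1)[OF U(2)] card_image[OF strict_mono_on_imp_inj_on[OF mono]] by simp
    then have "Z t = f ` Z t0" using card_subset_eq[OF _ sub] Z(1)[OF t] by auto
    then show "\<exists>f. strict_mono_on (Z t0) f \<and> Z t = f ` Z t0 \<and> (\<forall>z\<in>Z t0. \<bar>f z - z\<bar> < e)"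
      using mono f d(4) by (intro exI[of _ f]) (force simp: abs_less_iff)
  qed
qed

text \<open>
  Continuity of the ordered zero comes from the perturbation lemma. For the derivative, let \<open>z\<close> be the zero at \<open>t0\<close>
  and \<open>p t0 = (X - z) * l\<close>. Evaluating \<open>p t = p t0 + (a t - a t0) R\<close> at the zero \<open>\<xi> t\<close> of \<open>p t\<close> gives
  \<open>(\<xi> t - z) * l(\<xi> t) = - (a t - a t0) * R(\<xi> t)\<close>, and dividing by \<open>(t - t0) * l(\<xi> t)\<close> the limit can be taken.
\<close>
lemma ordered_zero_derivative:
  fixes p :: "real \<Rightarrow> real poly" and Z :: "real \<Rightarrow> real set"
  assumes U: "open U"
    and Z: "\<And>t. t \<in> U \<Longrightarrow> finite (Z t) \<and> card (Z t) = n" "\<And>t x. t \<in> U \<Longrightarrow> poly (p t) x = 0 \<longleftrightarrow> x \<in> Z t"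
    and simple: "\<And>t z. t \<in> U \<Longrightarrow> z \<in> Z t \<Longrightarrow> poly (pderiv (p t)) z \<noteq> 0"
    and p: "\<And>t. t \<in> U \<Longrightarrow> p t = P + smult (a t) R"
    and a: "\<And>t. t \<in> U \<Longrightarrow> (a has_real_derivative D t) (at t)" and D: "continuous_on U D"
    and k: "k < n"
  defines "\<xi> \<equiv> \<lambda>t. sorted_list_of_set (Z t) ! k"
  shows "\<And>t. t \<in> U \<Longrightarrow> \<xi> t \<in> Z t"
    and "\<And>t. t \<in> U \<Longrightarrow> (\<xi> has_real_derivative - D t * poly R (\<xi> t) / poly (pderiv (p t)) (\<xi> t)) (at t)"
    and "continuous_on U (\<lambda>t. - D t * poly R (\<xi> t) / poly (pderiv (p t)) (\<xi> t))"
proof -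
  show mem: "\<xi> t \<in> Z t" if t: "t \<in> U" for t
    using Z(1)[OF t] k nth_mem[of k "sorted_list_of_set (Z t)"] by (simp add: \<xi>_def)
  have pt: "poly (p t) x = poly P x + a t * poly R x" if "t \<in> U" for t x using p[OF that] by simp
  have ca: "isCont a t" if "t \<in> U" for t using a[OF that] by (rule DERIV_isCont)
  have cont: "isCont \<xi> t0" if t0: "t0 \<in> U" for t0
    unfolding isCont_def tendsto_iff
  proof (intro allI impI)
    fix e :: real assume e: "0 < e"
    have "isCont (\<lambda>t. poly (p t) x) t0" for x
    proof -
      have "isCont (\<lambda>t. poly P x + a t * poly R x) t0" using ca[OF t0] by (intro continuous_intros)
      moreover have "eventually (\<lambda>t. poly (p t) x = poly P x + a t * poly R x) (nhds t0)"
        using eventually_nhds_in_open[OF U t0] by eventually_elim (rule pt)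
      ultimately show ?thesis by (subst isCont_cong) auto
    qed
    then have "eventually (\<lambda>t. \<exists>f. strict_mono_on (Z t0) f \<and> Z t = f ` Z t0 \<and> (\<forall>z\<in>Z t0. \<bar>f z - z\<bar> < e)) (at t0)"
      using simple[OF t0] by (intro simple_zeros_perturbation[OF U t0 Z _ _ e])
    then show "eventually (\<lambda>t. dist (\<xi> t) (\<xi> t0) < e) (at t0)"
    proof eventually_elim
      case (elim t)
      then obtain f where f: "strict_mono_on (Z t0) f" "Z t = f ` Z t0" "\<forall>z\<in>Z t0. \<bar>f z - z\<bar> < e" by blast
      have "\<xi> t = f (\<xi> t0)"
        using f(1) Z(1)[OF t0] k unfolding \<xi>_def f(2)
        by (subst sorted_list_of_set_image_strict_mono) auto
      then show ?case using f(3) mem[OF t0] by (simp add: dist_real_def)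
    qed
  qed
  show "(\<xi> has_real_derivative - D t0 * poly R (\<xi> t0) / poly (pderiv (p t0)) (\<xi> t0)) (at t0)"
    if t0: "t0 \<in> U" for t0
  proof -
    define z where "z = \<xi> t0"
    have z: "z \<in> Z t0" unfolding z_def by (rule mem[OF t0])
    then have "poly (p t0) z = 0" using Z(2)[OF t0] by simp
    then obtain l where l: "p t0 = [:-z, 1:] * l" unfolding poly_eq_0_iff_dvd by blast
    have "pderiv (p t0) = [:-z, 1:] * pderiv l + l * pderiv [:-z, 1:]"
      unfolding l by (rule pderiv_mult)
    then have lz: "poly (pderiv (p t0)) z = poly l z" by (simp add: pderiv_pCons)
    have lnz: "poly l z \<noteq> 0" using simple[OF t0 z] lz by simp
    have lim: "(\<xi> \<longlongrightarrow> z) (at t0)" using cont[OF t0] by (simp add: isCont_def z_def)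
    have liml: "((\<lambda>t. poly l (\<xi> t)) \<longlongrightarrow> poly l z) (at t0)"
      and limR: "((\<lambda>t. poly R (\<xi> t)) \<longlongrightarrow> poly R z) (at t0)"
      by (rule tendsto_poly[OF lim])+
    have "((\<lambda>t. - ((a t - a t0) / (t - t0)) * poly R (\<xi> t) / poly l (\<xi> t)) \<longlongrightarrow> - D t0 * poly R z / poly l z) (at t0)"
      using a[OF t0] lnz unfolding has_field_derivative_iff by (intro tendsto_intros liml limR)
    moreover have "eventually (\<lambda>t. - ((a t - a t0) / (t - t0)) * poly R (\<xi> t) / poly l (\<xi> t) = (\<xi> t - \<xi> t0) / (t - t0)) (at t0)"
      using tendsto_imp_eventually_ne[OF liml lnz] eventually_at_in_open[OF U t0]
    proof eventually_elim
      case (elim t)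
      then have t: "t \<in> U" "t \<noteq> t0" by auto
      have "poly (p t) (\<xi> t) = 0" using mem[OF t(1)] Z(2)[OF t(1)] by simp
      then have "poly (p t0) (\<xi> t) + (a t - a t0) * poly R (\<xi> t) = 0"
        using pt[OF t(1)] pt[OF t0] by (simp add: algebra_simps)
      then have "(\<xi> t - z) * poly l (\<xi> t) = - (a t - a t0) * poly R (\<xi> t)"
        by (simp add: l algebra_simps)
      then have "\<xi> t - z = - (a t - a t0) * poly R (\<xi> t) / poly l (\<xi> t)"
        using elim(1) by (simp add: field_simps)
      moreover have "- (h / k) * r / m = (- h * r / m) / k" for h k r m :: real
        by (simp add: mult.commute)
      ultimately show ?case by (simp only: z_def)
    qed
    ultimately have "((\<lambda>t. (\<xi> t - \<xi> t0) / (t - t0)) \<longlongrightarrow> - D t0 * poly R z / poly l z) (at t0)"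
      by (rule Lim_transform_eventually)
    then show ?thesis unfolding has_field_derivative_iff using lz by (simp add: z_def)
  qed
  have c\<xi>: "continuous_on U \<xi>" and c_a: "continuous_on U a"
    using cont ca by (auto intro: continuous_at_imp_continuous_on)
  have "continuous_on U (\<lambda>t. - D t * poly R (\<xi> t) / (poly (pderiv P) (\<xi> t) + a t * poly (pderiv R) (\<xi> t)))"
  proof (intro continuous_intros c\<xi> c_a D ballI)
    fix t assume t: "t \<in> U"
    show "poly (pderiv P) (\<xi> t) + a t * poly (pderiv R) (\<xi> t) \<noteq> 0"
      using simple[OF t mem[OF t]] p[OF t] by (simp add: pderiv_add pderiv_smult)
  qed
  then show "continuous_on U (\<lambda>t. - D t * poly R (\<xi> t) / poly (pderiv (p t)) (\<xi> t))"
    by (rule continuous_on_eq) (simp add: p pderiv_add pderiv_smult)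
qed

text \<open>
  By \<open>ordered_zero_derivative\<close>, the derivative of the zero \<open>z\<close> is minus the quantity
  shown here to be positive. Let \<open>u\<close> be the tilted weight and \<open>p = (X - z) * q\<close> its orthogonal polynomial. Differentiating the
  orthogonality of \<open>p\<close> and \<open>q\<close> in \<open>t\<close>, with \<open>q\<close> kept fixed, shows that \<open>D R q\<close> and
  \<open>x rker t x p q\<close> have the same integral against \<open>u\<close>. Because \<open>p\<close> is orthogonal to \<open>q\<close>, the factor
  \<open>x rker t x\<close> may be replaced by its difference from its value at \<open>z\<close>, which is
  \<open>(x - z) rker t z rker t x\<close>. As \<open>(x - z) q = p\<close>, the integral is a positive multiple of that of \<open>rker t x p\<^sup>2\<close>.
  On the other side Gauss quadrature reduces the integral of \<open>D R q\<close> to its single term at \<open>z\<close>, because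
  \<open>q\<close> vanishes at the other zeros.
\<close>
lemma markov_sign:
  assumes v: "pos_weight v" and n: "1 \<le> n"
    and a: "\<And>t. t \<in> {-1<..<1} \<Longrightarrow> orth_poly (tilt v t) n = orth_poly v n + smult (a t) (orth_poly v (n - 1))"
    and t: "t \<in> {-1<..<1}" and D: "(a has_real_derivative D) (at t)"
    and z: "z \<in> zeros (tilt v t) n"
  shows "0 < D * poly (orth_poly v (n - 1)) z / poly (pderiv (orth_poly (tilt v t) n)) z"
proof -
  define P R u where "P = orth_poly v n" and "R = orth_poly v (n - 1)" and "u = tilt v t"
  define p q where "p = orth_poly u n" and "q = cofactor u n z"
  have u: "pos_weight u" unfolding u_def by (rule pos_weight_tilt[OF v t])
  have zu: "z \<in> zeros u n" using z by (simp add: u_def)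
  have z1: "z \<in> {-1..1}" using zeros_subset[of u n] zu by auto
  note Q = cofactor[OF u zu, folded p_def q_def]
  have qb: "deg_less n q" using Q(2) n by (auto simp: deg_less_def)
  have p: "is_orth_poly u n p" unfolding p_def by (rule is_orth_poly_orth_poly[OF u])
  have pPR: "p = P + smult (a t) R" using a[OF t] by (simp add: p_def u_def P_def R_def)
  have zero: "wint v (\<lambda>x. poly (P * q) x * rker s x) + a s * wint v (\<lambda>x. poly (R * q) x * rker s x) = 0"
    if s: "s \<in> {-1<..<1}" for s
  proof -
    note us = pos_weight_tilt[OF v s]
    have "wint (tilt v s) (poly (orth_poly (tilt v s) n * q)) = 0"
      using is_orth_poly_orth_poly[OF us, of n] qb by (simp add: is_orth_poly_def)
    moreover have "orth_poly (tilt v s) n * q = P * q + smult (a s) (R * q)"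
      using a[OF s] by (simp add: P_def R_def algebra_simps)
    ultimately have "wint (tilt v s) (poly (P * q)) + a s * wint (tilt v s) (poly (R * q)) = 0"
      by (simp only: wint_poly_add[OF us] wint_poly_smult)
    then show ?thesis by (simp only: wint_tilt)
  qed
  define G where "G = (\<lambda>f. wint v (\<lambda>x. - (x * poly f x * rker t x * rker t x)))"
  have "((\<lambda>s. wint v (\<lambda>x. poly (P * q) x * rker s x) + a s * wint v (\<lambda>x. poly (R * q) x * rker s x))
      has_real_derivative G (P * q) + (D * wint v (\<lambda>x. poly (R * q) x * rker t x) + G (R * q) * a t)) (at t)"
    unfolding G_def
    by (intro DERIV_add DERIV_mult wint_rker_deriv[OF v continuous_on_poly_wint t] D)
  moreover have "((\<lambda>s. wint v (\<lambda>x. poly (P * q) x * rker s x) + a s * wint v (\<lambda>x. poly (R * q) x * rker s x))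
      has_real_derivative 0) (at t)"
    by (rule has_field_derivative_transform_within_open[OF DERIV_const _ t]) (use zero in auto)
  ultimately have 1: "G (P * q) + (D * wint v (\<lambda>x. poly (R * q) x * rker t x) + G (R * q) * a t) = 0"
    by (rule DERIV_unique)
  have "wint v (\<lambda>x. - (x * poly (p * q) x * rker t x * rker t x))
     = wint v (\<lambda>x. - (x * poly (P * q) x * rker t x * rker t x) + a t * - (x * poly (R * q) x * rker t x * rker t x))"
    by (rule wint_cong) (simp add: pPR algebra_simps)
  also have "\<dots> = G (P * q) + a t * G (R * q)"
    unfolding G_def wint_cmult[symmetric]
    by (rule wint_add[OF v]) (intro continuous_intros continuous_on_rker t)+
  finally have 2: "wint v (\<lambda>x. - (x * poly (p * q) x * rker t x * rker t x)) = G (P * q) + a t * G (R * q)" .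
  have 3: "D * wint u (poly (R * q)) = - wint v (\<lambda>x. - (x * poly (p * q) x * rker t x * rker t x))"
    using 1 2 by (simp add: u_def wint_tilt mult.commute)
  have pp: "0 < wint (tilt u t) (poly (p * p))"
    using is_orth_poly_nonzero[OF p] by (intro wint_poly_pos pos_weight_tilt[OF u t]) auto
  have "wint v (\<lambda>x. - (x * poly (p * q) x * rker t x * rker t x))
      = wint u (\<lambda>x. - (z * rker t z) * poly (p * q) x + - rker t z * (poly (p * p) x * rker t x))"
    unfolding u_def tilt_def
  proof (rule wint_cong)
    fix x :: real assume x: "x \<in> {-1..1}"
    have "1 + t * x > 0" "1 + t * z > 0" using x z1 t one_plus_pos by blast+
    then have "x * rker t x = z * rker t z + (x - z) * rker t z * rker t x"
      by (simp add: rker_def divide_simps) (simp add: algebra_simps)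
    moreover have "poly p x = (x - z) * poly q x" unfolding Q(1) by (simp add: algebra_simps)
    then have "poly (p * p) x = (x - z) * poly (p * q) x" by simp
    ultimately show "- (x * poly (p * q) x * rker t x * rker t x) * v x =
      (- (z * rker t z) * poly (p * q) x + - rker t z * (poly (p * p) x * rker t x)) * (rker t x * v x)"
      by algebra
  qed
  also have "\<dots> = - (z * rker t z) * wint u (poly (p * q)) + - rker t z * wint (tilt u t) (poly (p * p))"
    unfolding wint_cmult[symmetric] wint_tilt
    by (rule wint_add[OF u]) (intro continuous_intros continuous_on_rker t)+
  also have "wint u (poly (p * q)) = 0" using p qb by (simp add: is_orth_poly_def)
  finally have "D * wint u (poly (R * q)) = rker t z * wint (tilt u t) (poly (p * p))"
    using 3 by (simp del: poly_mult)
  then have pos: "0 < D * wint u (poly (R * q))" using pp rker_pos[OF t z1] by simp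
  have "deg_less (2 * n) (R * q)"
  proof -
    have "degree R = n - 1" using is_orth_poly_orth_poly[OF v, of "n - 1"] by (simp add: R_def is_orth_poly_def)
    then have "degree (R * q) < 2 * n" using degree_mult_le[of R q] Q(2) n by linarith
    then show ?thesis by (simp add: deg_less_def)
  qed
  then have "wint u (poly (R * q)) = (\<Sum>y\<in>zeros u n. christoffel u n y * poly (R * q) y)"
    by (rule gauss_quadrature[OF u])
  also have "\<dots> = (\<Sum>y\<in>zeros u n. if y = z then christoffel u n z * poly (R * q) z else 0)"
    by (intro sum.cong) (use Q(4) in auto)
  also have "\<dots> = christoffel u n z * poly (R * q) z"
    using orth_poly_factorization(1)[OF u] zu by simp
  finally have "0 < christoffel u n z * (D * poly R z * poly q z)"
    using pos by (simp add: algebra_simps)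
  then have "0 < D * poly R z * poly q z"
    using christoffel_pos[OF u zu] by (simp add: zero_less_mult_iff)
  then have "0 < D * poly R z / poly q z" by (simp add: zero_less_mult_iff zero_less_divide_iff)
  then show ?thesis
    using pderiv_orth_poly_zero[OF u zu] by (simp add: R_def u_def q_def)
qed

theorem zeros_tilt_decreasing:
  assumes v: "pos_weight v" and k: "k < n"
  defines "\<xi> \<equiv> \<lambda>t. sorted_list_of_set (zeros (tilt v t) n) ! k"
  shows "\<xi> C1_differentiable_on {-1<..<1}" and "strict_antimono_on {-1<..<1} \<xi>"
proof -
  let ?U = "{-1<..<1::real}"
  have n: "1 \<le> n" using k by simp
  obtain a D where aD: "continuous_on ?U D" "\<And>t. t \<in> ?U \<Longrightarrow> (a has_real_derivative D t) (at t)"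
    "\<And>t. t \<in> ?U \<Longrightarrow> orth_poly (tilt v t) n = orth_poly v n + smult (a t) (orth_poly v (n - 1))"
    using orth_poly_tilt[OF v n] by blast
  define E where "E = (\<lambda>t. - D t * poly (orth_poly v (n - 1)) (\<xi> t) / poly (pderiv (orth_poly (tilt v t) n)) (\<xi> t))"
  have vt: "pos_weight (tilt v t)" if "t \<in> ?U" for t by (rule pos_weight_tilt[OF v that])
  have Z: "finite (zeros (tilt v t) n) \<and> card (zeros (tilt v t) n) = n" if "t \<in> ?U" for t
    using orth_poly_factorization[OF vt[OF that]] by blast
  have simple: "poly (pderiv (orth_poly (tilt v t) n)) z \<noteq> 0" if "t \<in> ?U" "z \<in> zeros (tilt v t) n" for t z
    using pderiv_orth_poly_zero[OF vt[OF that(1)] that(2)] cofactor(3)[OF vt[OF that(1)] that(2)] by simp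
  note path = ordered_zero_derivative[of ?U "\<lambda>t. zeros (tilt v t) n" n "\<lambda>t. orth_poly (tilt v t) n",
      OF _ Z poly_orth_poly_eq_0_iff[OF vt] simple aD(3,2,1) k]
  have mem: "\<xi> t \<in> zeros (tilt v t) n" if "t \<in> ?U" for t using path(1) that unfolding \<xi>_def by auto
  have der: "(\<xi> has_real_derivative E t) (at t)" if "t \<in> ?U" for t
    using path(2) that unfolding E_def \<xi>_def by auto
  have "continuous_on ?U E" using path(3) unfolding E_def \<xi>_def by auto
  with der show "\<xi> C1_differentiable_on ?U"
    unfolding C1_differentiable_on_def has_real_derivative_iff_has_vector_derivative by blast
  have neg: "E t < 0" if t: "t \<in> ?U" for t
    using markov_sign[OF v n aD(3) t aD(2)[OF t] mem[OF t]] by (simp add: E_def)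
  show "strict_antimono_on ?U \<xi>"
  proof (rule monotone_onI)
    fix r s :: real assume rs: "r \<in> ?U" "s \<in> ?U" "r < s"
    show "\<xi> r > \<xi> s"
    proof (rule DERIV_neg_imp_decreasing[OF rs(3)])
      fix x assume "r \<le> x" "x \<le> s"
      then have "x \<in> ?U" using rs by auto
      then show "\<exists>y. (\<xi> has_real_derivative y) (at x) \<and> y < 0" using der neg by blast
    qed
  qed
qed

section \<open>Partial fractions\<close>

definition kernel_prod :: "nat set \<Rightarrow> (nat \<Rightarrow> real) \<Rightarrow> real poly" where
  "kernel_prod I \<tau> = (\<Prod>i\<in>I. [:1, \<tau> i:])"

lemma kernel_prod_remove: "finite I \<Longrightarrow> j \<in> I \<Longrightarrow> kernel_prod I \<tau> = [:1, \<tau> j:] * kernel_prod (I - {j}) \<tau>"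
  unfolding kernel_prod_def by (rule prod.remove)

lemma deg_less_kernel_prod: "finite I \<Longrightarrow> deg_less (Suc (card I)) (kernel_prod I \<tau>)"
  unfolding kernel_prod_def deg_less_def
  using degree_prod_sum_le[of I "\<lambda>i. [:1, \<tau> i:]"] sum_bounded_above[of I "\<lambda>i. degree [:1, \<tau> i:]" 1]
  by (force simp: less_Suc_eq_le)

lemma poly_kernel_prod_pos:
  assumes "finite I" "\<tau> ` I \<subseteq> {-1<..<1}" "x \<in> {-1..1}"
  shows "0 < poly (kernel_prod I \<tau>) x"
  unfolding kernel_prod_def poly_prod
proof (rule prod_pos)
  fix i assume "i \<in> I"
  then show "0 < poly [:1, \<tau> i:] x" using assms one_plus_pos[of "\<tau> i" x] by (auto simp: mult.commute)
qed

lemma coeff_kernel_prod_card: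
  assumes "finite I"
  shows "coeff (kernel_prod I \<tau>) (card I) = (\<Prod>i\<in>I. \<tau> i)"
  using assms
proof (induction I rule: finite_induct)
  case (insert i I)
  have "coeff (kernel_prod I \<tau>) (Suc (card I)) = 0" using deg_less_kernel_prod[OF insert(1), of \<tau>] by (simp add: deg_less_coeff)
  moreover have "kernel_prod (insert i I) \<tau> = [:1, \<tau> i:] * kernel_prod I \<tau>" using insert by (simp add: kernel_prod_def)
  ultimately show ?case using insert by simp
qed (simp add: kernel_prod_def)

lemma kernel_prod_nonvanishing:
  assumes "finite I" "t \<notin> \<tau> ` I"
  shows "t = 0 \<Longrightarrow> coeff (kernel_prod I \<tau>) (card I) \<noteq> 0"
    and "t \<noteq> 0 \<Longrightarrow> poly (kernel_prod I \<tau>) (- 1 / t) \<noteq> 0"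
  using assms by (auto simp: coeff_kernel_prod_card) (auto simp: kernel_prod_def poly_prod field_simps)

text \<open>
  Splitting off one pole at a time: division by \<open>1 + \<tau> i X\<close> with the product of the other factors as
  the remainder term leaves a quotient to which the induction hypothesis applies. The case \<open>\<tau> i = 0\<close>, whose factor
  is the constant 1, is covered by the division lemma.
\<close>
lemma partial_fractions:
  assumes "finite I" "inj_on \<tau> I" "deg_less (card I) q"
  shows "\<exists>c. q = (\<Sum>i\<in>I. smult (c i) (kernel_prod (I - {i}) \<tau>))"
  using assms
proof (induction I arbitrary: q rule: finite_induct)
  case empty
  then show ?case by (simp add: deg_less_def)
next
  case (insert i I)
  have ti: "\<tau> i \<notin> \<tau> ` I" using insert by auto
  have "deg_less (Suc (card I)) q" using insert by simp
  then obtain C Q where Q: "q = smult C (kernel_prod I \<tau>) + [:1, \<tau> i:] * Q" "deg_less (card I) Q"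
    using division_by_kernel[OF _ deg_less_kernel_prod[OF insert(1)] kernel_prod_nonvanishing[OF insert(1) ti]] by blast
  obtain c where c: "Q = (\<Sum>j\<in>I. smult (c j) (kernel_prod (I - {j}) \<tau>))"
    using insert.IH[OF _ Q(2)] insert.prems by auto
  have step: "kernel_prod (insert i I - {j}) \<tau> = [:1, \<tau> i:] * kernel_prod (I - {j}) \<tau>" if "j \<in> I" for j
  proof -
    have "insert i I - {j} = insert i (I - {j})" using insert(2) that by auto
    then show ?thesis using insert(1,2) by (simp add: kernel_prod_def)
  qed
  have "(\<Sum>j\<in>insert i I. smult ((c(i := C)) j) (kernel_prod (insert i I - {j}) \<tau>)) =
      smult C (kernel_prod I \<tau>) + (\<Sum>j\<in>I. smult (c j) (kernel_prod (insert i I - {j}) \<tau>))"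
  proof -
    have "insert i I - {i} = I" using insert(2) by auto
    moreover have "(\<Sum>j\<in>I. smult ((c(i := C)) j) (kernel_prod (insert i I - {j}) \<tau>)) =
        (\<Sum>j\<in>I. smult (c j) (kernel_prod (insert i I - {j}) \<tau>))"
      by (rule sum.cong) (use insert(2) in auto)
    ultimately show ?thesis using insert(1,2) by simp
  qed
  also have "(\<Sum>j\<in>I. smult (c j) (kernel_prod (insert i I - {j}) \<tau>)) = [:1, \<tau> i:] * Q"
    unfolding c sum_distrib_left by (intro sum.cong refl) (simp only: step mult_smult_right)
  finally show ?case using Q(1) by metis
qed

lemma deriv_rker:
  assumes "t \<in> {-1<..<1}" "x \<in> {-1..1}"
  shows "deriv (\<lambda>s. rker s x) t = - x / (1 + t * x)\<^sup>2"
proof (rule DERIV_imp_deriv)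
  have "1 + t * x \<noteq> 0" using one_plus_pos[OF assms] by simp
  then show "((\<lambda>s. rker s x) has_real_derivative - x / (1 + t * x)\<^sup>2) (at t)"
    unfolding rker_def by (auto intro!: derivative_eq_intros simp: power2_eq_square)
qed

text \<open>
  With \<open>m\<close> distinct parameters and one further \<open>t\<close>, all quotients have the common denominator \<open>den\<close>. When \<open>t\<close> is
  one of the parameters, \<open>den\<close> has a double factor, which is exactly what the derivative of the kernel accounts for.
\<close>
locale kernels =
  fixes m :: nat and \<tau> :: "nat \<Rightarrow> real" and t :: real
  assumes tau: "\<tau> ` {1..m} \<subseteq> {-1<..<1}" and inj: "inj_on \<tau> {1..m}" and t: "t \<in> {-1<..<1}"
begin

abbreviation K :: "real poly" where "K \<equiv> kernel_prod {1..m} \<tau>"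
abbreviation Kj :: "nat \<Rightarrow> real poly" where "Kj j \<equiv> kernel_prod ({1..m} - {j}) \<tau>"
definition den :: "real poly" where "den = [:1, t:] * K"

lemma K_pos: "x \<in> {-1..1} \<Longrightarrow> 0 < poly K x"
  by (rule poly_kernel_prod_pos) (use tau in auto)

lemma poly_den: "poly den x = (1 + t * x) * poly K x"
  by (simp add: den_def algebra_simps)

lemma den_pos: "x \<in> {-1..1} \<Longrightarrow> 0 < poly den x"
  unfolding poly_den by (intro mult_pos_pos one_plus_pos[OF t] K_pos)

lemma tau_mem: "j \<in> {1..m} \<Longrightarrow> \<tau> j \<in> {-1<..<1}"
  using tau by blast

lemma zeros_of_quotient:
  assumes "\<And>x. x \<in> {-1..1} \<Longrightarrow> f x = poly p x / poly den x"
  shows "{x \<in> {-1<..<1}. f x = 0} = {x \<in> {-1<..<1}. poly p x = 0}"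
proof (rule Collect_cong, rule conj_cong[OF refl])
  fix x :: real assume "x \<in> {-1<..<1}"
  then have x: "x \<in> {-1..1}" by simp
  then show "f x = 0 \<longleftrightarrow> poly p x = 0" using assms[OF x] den_pos[OF x] by simp
qed

lemma deg_less_Kj: "j \<in> {1..m} \<Longrightarrow> deg_less m (Kj j)"
  using deg_less_kernel_prod[of "{1..m} - {j}" \<tau>] by simp

lemma rker_eq:
  assumes "j \<in> {1..m}" "x \<in> {-1..1}"
  shows "rker (\<tau> j) x = poly (Kj j) x / poly K x"
    and "rker (\<tau> j) x = poly ([:1, t:] * Kj j) x / poly den x"
proof -
  have K: "poly K x = (1 + \<tau> j * x) * poly (Kj j) x"
    using kernel_prod_remove[of "{1..m}" j \<tau>] assms(1) by (simp add: algebra_simps)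
  have "1 + \<tau> j * x > 0" by (rule one_plus_pos[OF tau_mem[OF assms(1)] assms(2)])
  with K_pos[OF assms(2)] show 1: "rker (\<tau> j) x = poly (Kj j) x / poly K x"
    unfolding K by (auto simp: rker_def zero_less_mult_iff)
  have p: "poly ([:1, t:] * Kj j) x = (1 + t * x) * poly (Kj j) x" by (simp add: algebra_simps)
  show "rker (\<tau> j) x = poly ([:1, t:] * Kj j) x / poly den x"
    using one_plus_pos[OF t assms(2)] unfolding 1 p poly_den by simp
qed

text \<open>
  The leading function has a numerator that does not vanish at the zero of \<open>1 + t X\<close>. This makes it an admissible
  remainder term in the division by \<open>1 + t X\<close>, whether or not \<open>t\<close> is one of the parameters.
\<close>
lemma lead_numerator:
  obtains L where "deg_less (Suc m) L" "t = 0 \<Longrightarrow> coeff L m \<noteq> 0" "t \<noteq> 0 \<Longrightarrow> poly L (- 1 / t) \<noteq> 0"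
    "\<And>x. x \<in> {-1..1} \<Longrightarrow> lead_fun m \<tau> t x = poly L x / poly den x"
proof (cases "t \<in> \<tau> ` {1..m}")
  case False
  show ?thesis
  proof (rule that[of K])
    show "deg_less (Suc m) K" using deg_less_kernel_prod[of "{1..m}" \<tau>] by simp
    show "t = 0 \<Longrightarrow> coeff K m \<noteq> 0" using kernel_prod_nonvanishing(1)[OF _ False] by simp
    show "t \<noteq> 0 \<Longrightarrow> poly K (- 1 / t) \<noteq> 0" using kernel_prod_nonvanishing(2)[OF _ False] by simp
    fix x :: real assume "x \<in> {-1..1}"
    then show "lead_fun m \<tau> t x = poly K x / poly den x"
      using K_pos[of x] False by (simp add: lead_fun_def rker_def poly_den)
  qed
next
  case True
  then obtain l where l: "l \<in> {1..m}" "t = \<tau> l" by blast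
  have no: "t \<notin> \<tau> ` ({1..m} - {l})" 
  proof
    assume "t \<in> \<tau> ` ({1..m} - {l})"
    then obtain i where i: "i \<in> {1..m}" "i \<noteq> l" "\<tau> i = \<tau> l" using l(2) by fastforce
    then show False using inj_onD[OF inj i(3) i(1) l(1)] by blast
  qed
  have card: "card ({1..m} - {l}) = m - 1" using l by simp
  have m: "Suc (m - 1) = m" using l by auto
  show ?thesis
  proof (rule that[of "[:0, -1:] * Kj l"])
    show "deg_less (Suc m) ([:0, -1:] * Kj l)"
      unfolding deg_less_coeff using deg_less_Kj[OF l(1)]
      by (auto simp: deg_less_coeff coeff_pCons split: nat.splits)
    show "t = 0 \<Longrightarrow> coeff ([:0, -1:] * Kj l) m \<noteq> 0"
      using kernel_prod_nonvanishing(1)[OF _ no] card m by (auto simp: coeff_pCons split: nat.splits)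
    show "t \<noteq> 0 \<Longrightarrow> poly ([:0, -1:] * Kj l) (- 1 / t) \<noteq> 0"
      using kernel_prod_nonvanishing(2)[OF _ no] by simp
    fix x :: real assume x: "x \<in> {-1..1}"
    have K: "poly K x = (1 + t * x) * poly (Kj l) x"
      using kernel_prod_remove[of "{1..m}" l \<tau>] l by (simp add: algebra_simps)
    have "poly (Kj l) x \<noteq> 0" using K_pos[OF x] K by auto
    then show "lead_fun m \<tau> t x = poly ([:0, -1:] * Kj l) x / poly den x"
      using True deriv_rker[OF t x] by (simp add: lead_fun_def poly_den K power2_eq_square del: One_nat_def)
  qed
qed

lemma continuous_lead: "continuous_on {-1..1} (lead_fun m \<tau> t)"
proof -
  obtain L where L: "\<And>x. x \<in> {-1..1} \<Longrightarrow> lead_fun m \<tau> t x = poly L x / poly den x"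
    using lead_numerator by metis
  have "continuous_on {-1..1} (\<lambda>x. poly L x / poly den x)"
    using den_pos by (intro continuous_intros) force
  then show ?thesis by (rule continuous_on_eq) (simp add: L)
qed

lemma sum_rker:
  assumes "x \<in> {-1..1}"
  shows "(\<Sum>j=1..m. c j * rker (\<tau> j) x) = poly ([:1, t:] * (\<Sum>j=1..m. smult (c j) (Kj j))) x / poly den x"
proof -
  have "(\<Sum>j=1..m. c j * rker (\<tau> j) x) = (\<Sum>j=1..m. c j * (poly ([:1, t:] * Kj j) x / poly den x))"
    by (rule sum.cong[OF refl]) (subst rker_eq(2)[OF _ assms], assumption, rule refl)
  also have "\<dots> = (\<Sum>j=1..m. poly ([:1, t:] * smult (c j) (Kj j)) x / poly den x)"
    by (rule sum.cong[OF refl]) simp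
  finally show ?thesis by (simp only: sum_distrib_left poly_sum sum_divide_distrib)
qed

lemma numerator_of_combination:
  obtains p where "deg_less (Suc m) p"
    "\<And>x. x \<in> {-1..1} \<Longrightarrow> lead_fun m \<tau> t x + (\<Sum>j=1..m. c j * rker (\<tau> j) x) = poly p x / poly den x"
proof -
  obtain L where L: "deg_less (Suc m) L" "\<And>x. x \<in> {-1..1} \<Longrightarrow> lead_fun m \<tau> t x = poly L x / poly den x"
    using lead_numerator by metis
  define Q where "Q = (\<Sum>j=1..m. smult (c j) (Kj j))"
  have "deg_less m Q" using deg_less_Kj by (auto simp: Q_def deg_less_coeff coeff_sum intro!: sum.neutral)
  then have "deg_less (Suc m) ([:1, t:] * Q)"
    by (auto simp: deg_less_coeff coeff_pCons split: nat.splits)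
  with L(1) have "deg_less (Suc m) (L + [:1, t:] * Q)" by (rule deg_less_simps(2))
  then show ?thesis
    by (rule that) (simp only: sum_rker L(2) Q_def[symmetric] poly_add add_divide_distrib)
qed

text \<open>
  The converse of the preceding lemma: the leading function and the kernels span all quotients with numerator of degree at
  most \<open>m\<close>. The last conclusion serves to show that the leading function really occurs.
\<close>
lemma combination_of_numerator:
  assumes "deg_less (Suc m) q"
  obtains C c Q where "\<And>x. x \<in> {-1..1} \<Longrightarrow>
      poly q x / poly den x = C * lead_fun m \<tau> t x + (\<Sum>j=1..m. c j * rker (\<tau> j) x)"
    "deg_less m Q" "C = 0 \<Longrightarrow> q = [:1, t:] * Q"
proof -
  obtain L where L: "deg_less (Suc m) L" "t = 0 \<Longrightarrow> coeff L m \<noteq> 0" "t \<noteq> 0 \<Longrightarrow> poly L (- 1 / t) \<noteq> 0"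
    "\<And>x. x \<in> {-1..1} \<Longrightarrow> lead_fun m \<tau> t x = poly L x / poly den x"
    using lead_numerator by metis
  obtain C Q where Q: "q = smult C L + [:1, t:] * Q" "deg_less m Q"
    using division_by_kernel[OF assms L(1-3)] by blast
  obtain c where c: "Q = (\<Sum>i\<in>{1..m}. smult (c i) (Kj i))"
    using partial_fractions[OF _ inj] Q(2) by auto
  show ?thesis
  proof (rule that[OF _ Q(2)])
    fix x :: real assume x: "x \<in> {-1..1}"
    show "poly q x / poly den x = C * lead_fun m \<tau> t x + (\<Sum>j=1..m. c j * rker (\<tau> j) x)"
      unfolding sum_rker[OF x] c[symmetric] L(4)[OF x]
      by (simp only: Q(1) poly_add poly_smult add_divide_distrib times_divide_eq_right)
  next
    assume "C = 0"
    then show "q = [:1, t:] * Q" using Q(1) by simp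
  qed
qed

end

section \<open>Quadrature nodes as zeros of orthogonal polynomials\<close>

text \<open>
  Writing \<open>orth_fun\<close> as a numerator \<open>p\<close> over \<open>den\<close> and each kernel as \<open>Kj j / K\<close>, the product of the two
  becomes \<open>p * Kj j\<close> over \<open>den * K\<close>. The polynomials \<open>Kj j\<close> span all degrees below \<open>n\<close>, so the
  conditions say that \<open>p\<close> is orthogonal to these for the weight \<open>w / (den * K)\<close>. Conversely, in the expansion of the
  orthogonal polynomial over \<open>den\<close> the leading function has a coefficient \<open>C \<noteq> 0\<close>, and one can divide by it:
  otherwise \<open>p = (1 + t X) * Q\<close> with \<open>Q\<close> of degree below \<open>n\<close>, and \<open>p * Q\<close> would have a positive integral.
\<close>
lemma is_orth_nodes_iff:
  assumes w: "pos_weight w" and n: "1 \<le> n"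
    and tau: "\<tau> ` {1..n} \<subseteq> {-1<..<1}" "inj_on \<tau> {1..n}" and t: "t \<in> {-1<..<1}"
  defines "V \<equiv> \<lambda>x. (1 / poly (kernel_prod {1..n} \<tau>) x)\<^sup>2 * w x"
  shows "pos_weight V" and "is_orth_nodes w n \<tau> t X \<longleftrightarrow> X = zeros (tilt V t) n"
proof -
  interpret kernels n \<tau> t using tau t by unfold_locales
  show V: "pos_weight V"
    unfolding V_def using K_pos by (intro pos_weight_mult w continuous_intros) force+
  define u where "u = tilt V t"
  have u: "pos_weight u" unfolding u_def by (rule pos_weight_tilt[OF V t])
  have orth: "wint w (\<lambda>x. orth_fun n \<tau> t c x * rker (\<tau> j) x) = wint u (poly (p * Kj j))"
    if "\<And>x. x \<in> {-1..1} \<Longrightarrow> orth_fun n \<tau> t c x = poly p x / poly den x" "j \<in> {1..n}" for c p j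
  proof (rule wint_cong)
    fix x :: real assume x: "x \<in> {-1..1}"
    have "rker t x = 1 / (1 + t * x)" by (rule rker_def)
    then show "orth_fun n \<tau> t c x * rker (\<tau> j) x * w x = poly (p * Kj j) x * u x"
      by (simp add: that(1)[OF x] rker_eq(1)[OF that(2) x] u_def tilt_def V_def poly_den power2_eq_square
          del: One_nat_def)
  qed
  show "is_orth_nodes w n \<tau> t X \<longleftrightarrow> X = zeros (tilt V t) n"
  proof
    assume "is_orth_nodes w n \<tau> t X"
    then obtain c where c: "\<And>j. j \<in> {1..n} \<Longrightarrow> wint w (\<lambda>x. orth_fun n \<tau> t c x * rker (\<tau> j) x) = 0"
        "X = {x \<in> {-1<..<1}. orth_fun n \<tau> t c x = 0}" "finite X"
      unfolding is_orth_nodes_def by blast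
    obtain p where p: "deg_less (Suc n) p" "\<And>x. x \<in> {-1..1} \<Longrightarrow> orth_fun n \<tau> t c x = poly p x / poly den x"
      using numerator_of_combination[of c] unfolding orth_fun_def by metis
    have "p = smult (coeff p n) (orth_poly u n)"
    proof (rule is_orth_poly_proportional[OF u is_orth_poly_orth_poly[OF u] p(1)])
      fix s :: "real poly" assume "deg_less n s"
      then obtain d where d: "s = (\<Sum>i\<in>{1..n}. smult (d i) (Kj i))"
        using partial_fractions[OF _ inj] by auto
      have "p * s = (\<Sum>i\<in>{1..n}. smult (d i) (p * Kj i))" by (simp add: d sum_distrib_left)
      moreover have "wint u (poly (p * Kj i)) = 0" if "i \<in> {1..n}" for i
        using orth[OF p(2) that] c(1)[OF that] by simp
      ultimately show "wint u (poly (p * s)) = 0"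
        by (simp add: wint_poly_sum[OF u] wint_poly_smult del: poly_mult)
    qed
    then obtain k where k: "p = smult k (orth_poly u n)" by blast
    have X: "X = {x \<in> {-1<..<1}. poly p x = 0}"
      unfolding c(2) using p(2) by (rule zeros_of_quotient)
    \<comment> \<open>A zero numerator would make every point of the interval a node.\<close>
    have "k \<noteq> 0"
    proof
      assume "k = 0"
      then have "X = {-1<..<1}" using X k by auto
      then show False using c(3) infinite_Ioo[of "-1::real" 1] by simp
    qed
    then show "X = zeros (tilt V t) n" using X k by (simp add: zeros_def u_def)
  next
    assume X: "X = zeros (tilt V t) n"
    define p where "p = orth_poly u n"
    have p: "is_orth_poly u n p" unfolding p_def by (rule is_orth_poly_orth_poly[OF u])
    have "deg_less (Suc n) p" using p by (simp add: deg_less_def is_orth_poly_def)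
    then obtain C c Q where c: "\<And>x. x \<in> {-1..1} \<Longrightarrow>
        poly p x / poly den x = C * lead_fun n \<tau> t x + (\<Sum>j=1..n. c j * rker (\<tau> j) x)"
      and Q: "deg_less n Q" "C = 0 \<Longrightarrow> p = [:1, t:] * Q"
      using combination_of_numerator by blast
    have C: "C \<noteq> 0"
    proof
      assume "C = 0"
      then have pQ: "p = [:1, t:] * Q" using Q by blast
      have "wint u (poly (p * Q)) = 0" using p Q(1) by (simp add: is_orth_poly_def)
      moreover have "0 < wint u (poly (p * Q))"
      proof (rule wint_poly_pos[OF u])
        show "p * Q \<noteq> 0" using is_orth_poly_nonzero[OF p] pQ by auto
        fix x :: real assume x: "x \<in> {-1<..<1}"
        have "poly (p * Q) x = (1 + t * x) * (poly Q x * poly Q x)" unfolding pQ by (simp add: algebra_simps)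
        moreover have "0 < 1 + t * x" using x by (intro one_plus_pos[OF t]) auto
        ultimately show "0 \<le> poly (p * Q) x" by (simp del: poly_mult)
      qed
      ultimately show False by simp
    qed
    define q c' where "q = smult (1 / C) p" and "c' = (\<lambda>j. c j / C)"
    have r: "orth_fun n \<tau> t c' x = poly q x / poly den x" if x: "x \<in> {-1..1}" for x
    proof -
      have "(\<Sum>j=1..n. c' j * rker (\<tau> j) x) = (\<Sum>j=1..n. c j * rker (\<tau> j) x) / C"
        by (simp add: c'_def sum_divide_distrib)
      then have "orth_fun n \<tau> t c' x = (C * lead_fun n \<tau> t x + (\<Sum>j=1..n. c j * rker (\<tau> j) x)) / C"
        using C by (simp add: orth_fun_def add_divide_distrib)
      then show ?thesis unfolding c[OF x, symmetric] by (simp add: q_def)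
    qed
    have X': "X = {x \<in> {-1<..<1}. poly q x = 0}" using C by (simp add: X zeros_def q_def p_def u_def)
    show "is_orth_nodes w n \<tau> t X"
      unfolding is_orth_nodes_def
    proof (intro exI[of _ c'] conjI ballI)
      fix j assume j: "j \<in> {1..n}"
      have "wint u (poly (p * Kj j)) = 0" using p deg_less_Kj[OF j] by (simp add: is_orth_poly_def)
      moreover have "q * Kj j = smult (1 / C) (p * Kj j)" by (simp add: q_def)
      ultimately show "wint w (\<lambda>x. orth_fun n \<tau> t c' x * rker (\<tau> j) x) = 0"
        using orth[OF r j] by (simp add: wint_poly_smult del: poly_mult)
    next
      show "X = {x \<in> {-1<..<1}. orth_fun n \<tau> t c' x = 0}"
        unfolding X' using r by (rule zeros_of_quotient[symmetric])
      show "finite X" "card X = n" using orth_poly_factorization[OF u, of n] by (simp_all add: X u_def)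
    next
      fix x assume x: "x \<in> X"
      then have xz: "x \<in> zeros u n" by (simp add: X u_def)
      have x1: "x \<in> {-1<..<1}" "poly q x = 0" using x X' by auto
      have dx: "poly den x > 0" using x1 by (intro den_pos) auto
      have "poly (pderiv p) x \<noteq> 0"
        using pderiv_orth_poly_zero[OF u xz] cofactor(3)[OF u xz] by (simp add: p_def)
      then have qx: "poly (pderiv q) x \<noteq> 0" using C by (simp add: q_def pderiv_smult)
      have "((\<lambda>x. poly q x / poly den x) has_real_derivative
          (poly (pderiv q) x * poly den x - poly q x * poly (pderiv den) x) / (poly den x * poly den x)) (at x)"
        using dx by (intro DERIV_divide poly_DERIV) auto
      then have "(orth_fun n \<tau> t c' has_real_derivative
          (poly (pderiv q) x * poly den x - poly q x * poly (pderiv den) x) / (poly den x * poly den x)) (at x)"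
        by (rule has_field_derivative_transform_within_open[OF _ _ x1(1)]) (use r in auto)
      then have "deriv (orth_fun n \<tau> t c') x = poly (pderiv q) x / poly den x"
        using x1 dx by (simp add: DERIV_imp_deriv)
      then show "deriv (orth_fun n \<tau> t c') x \<noteq> 0" using qx dx by simp
    qed
  qed
qed

text \<open>
  The \<open>2 n\<close> functions span the quotients of polynomials of degree below \<open>2 n\<close> by \<open>den\<close>, so the rule is
  exact on them if and only if it is, with rescaled weights, the classical Gauss rule for the weight \<open>w / den\<close>. Testing
  exactness on multiples of the node polynomial \<open>N\<close> shows that \<open>N\<close> is orthogonal to all degrees below \<open>n\<close>.
\<close>
lemma is_gauss_nodes_iff:
  assumes w: "pos_weight w" and n: "1 \<le> n"
    and tau: "\<tau> ` {1..2*n-1} \<subseteq> {-1<..<1}" "inj_on \<tau> {1..2*n-1}" and t: "t \<in> {-1<..<1}"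
  defines "V \<equiv> \<lambda>x. 1 / poly (kernel_prod {1..2*n-1} \<tau>) x * w x"
  shows "pos_weight V" and "is_gauss_nodes w n \<tau> t X \<longleftrightarrow> X = zeros (tilt V t) n"
proof -
  interpret kernels "2*n-1" \<tau> t using tau t by unfold_locales
  have m: "Suc (2*n-1) = 2*n" using n by simp
  show V: "pos_weight V"
    unfolding V_def using K_pos by (intro pos_weight_mult w continuous_intros) force+
  define u where "u = tilt V t"
  have u: "pos_weight u" unfolding u_def by (rule pos_weight_tilt[OF V t])
  have wint_numerator: "wint w f = wint u (poly q)" if "\<And>x. x \<in> {-1..1} \<Longrightarrow> f x = poly q x / poly den x" for f q
  proof (rule wint_cong)
    fix x :: real assume x: "x \<in> {-1..1}"
    show "f x * w x = poly q x * u x"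
      by (simp add: that[OF x] u_def tilt_def V_def poly_den rker_def del: One_nat_def)
  qed
  show "is_gauss_nodes w n \<tau> t X \<longleftrightarrow> X = zeros (tilt V t) n"
  proof
    assume "is_gauss_nodes w n \<tau> t X"
    then obtain \<beta> where X: "X \<subseteq> {-1<..<1}" "finite X" "card X = n"
      and b: "\<And>j. j \<in> {1..2*n-1} \<Longrightarrow> wint w (rker (\<tau> j)) = (\<Sum>x\<in>X. \<beta> x * rker (\<tau> j) x)"
        "wint w (lead_fun (2*n-1) \<tau> t) = (\<Sum>x\<in>X. \<beta> x * lead_fun (2*n-1) \<tau> t x)"
      unfolding is_gauss_nodes_def by blast
    have exact: "wint u (poly q) = (\<Sum>x\<in>X. \<beta> x * (poly q x / poly den x))" if q: "deg_less (2 * n) q" for q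
    proof -
      have "deg_less (Suc (2*n-1)) q" using q m by simp
      then obtain C c Q where c: "\<And>x. x \<in> {-1..1} \<Longrightarrow>
        poly q x / poly den x = C * lead_fun (2*n-1) \<tau> t x + (\<Sum>j=1..2*n-1. c j * rker (\<tau> j) x)"
        using combination_of_numerator by blast
      have cr: "continuous_on {-1..1} (\<lambda>x. c j * rker (\<tau> j) x)" if "j \<in> {1..2*n-1}" for j
        using tau_mem[OF that] by (intro continuous_intros continuous_on_rker)
      have "wint u (poly q) = wint w (\<lambda>x. C * lead_fun (2*n-1) \<tau> t x + (\<Sum>j=1..2*n-1. c j * rker (\<tau> j) x))"
        by (rule wint_numerator[symmetric]) (simp only: c)
      also have "\<dots> = wint w (\<lambda>x. C * lead_fun (2*n-1) \<tau> t x) + wint w (\<lambda>x. \<Sum>j=1..2*n-1. c j * rker (\<tau> j) x)"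
        by (intro wint_add[OF w] continuous_on_mult_left continuous_lead continuous_on_sum cr)
      also have "\<dots> = C * wint w (lead_fun (2*n-1) \<tau> t) + (\<Sum>j=1..2*n-1. c j * wint w (rker (\<tau> j)))"
        by (subst wint_sum[OF w _ cr]) (simp_all add: wint_cmult)
      also have "\<dots> = C * (\<Sum>x\<in>X. \<beta> x * lead_fun (2*n-1) \<tau> t x) + (\<Sum>j=1..2*n-1. c j * (\<Sum>x\<in>X. \<beta> x * rker (\<tau> j) x))"
        using b by simp
      also have "\<dots> = (\<Sum>x\<in>X. \<beta> x * (C * lead_fun (2*n-1) \<tau> t x)) + (\<Sum>x\<in>X. \<beta> x * (\<Sum>j=1..2*n-1. c j * rker (\<tau> j) x))"
        unfolding sum_distrib_left sum.swap[of "\<lambda>j x. c j * (\<beta> x * rker (\<tau> j) x)" X "{1..2*n-1}"]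
        by (simp only: mult.left_commute)
      also have "\<dots> = (\<Sum>x\<in>X. \<beta> x * (poly q x / poly den x))"
        unfolding sum.distrib[symmetric] distrib_left[symmetric]
      proof (rule sum.cong[OF refl])
        fix x assume "x \<in> X"
        then have "x \<in> {-1..1}" using X(1) by auto
        then show "\<beta> x * (C * lead_fun (2*n-1) \<tau> t x + (\<Sum>j=1..2*n-1. c j * rker (\<tau> j) x)) =
            \<beta> x * (poly q x / poly den x)" by (simp only: c)
      qed
      finally show ?thesis .
    qed
    define N where "N = (\<Prod>x\<in>X. [:-x, 1:])"
    have Nz: "poly N x = 0 \<longleftrightarrow> x \<in> X" for x using X(2) by (auto simp: N_def poly_prod)
    have "is_orth_poly u n N"
      unfolding is_orth_poly_def
    proof (intro conjI allI impI)
      show d: "degree N = n" using X(3) by (simp add: N_def degree_prod_linear)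
      show "lead_coeff N = 1" unfolding N_def by (simp add: lead_coeff_prod)
      fix s :: "real poly" assume "deg_less n s"
      then have "deg_less (2 * n) (N * s)"
        using d degree_mult_le[of N s] unfolding deg_less_def by auto
      then have "wint u (poly (N * s)) = (\<Sum>x\<in>X. \<beta> x * (poly (N * s) x / poly den x))" by (rule exact)
      also have "\<dots> = 0" by (rule sum.neutral) (simp add: Nz)
      finally show "wint u (poly (N * s)) = 0" .
    qed
    then have "orth_poly u n = N" using is_orth_poly_unique[OF u _ is_orth_poly_orth_poly[OF u]] by blast
    then show "X = zeros (tilt V t) n" using Nz X(1) by (auto simp: zeros_def u_def)
  next
    assume "X = zeros (tilt V t) n"
    then have X: "X = zeros u n" by (simp add: u_def)
    define \<beta> where "\<beta> = (\<lambda>x. christoffel u n x * poly den x)"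
    have X1: "x \<in> {-1..1}" if "x \<in> X" for x using that zeros_subset[of u n] X by auto
    have exact: "wint w f = (\<Sum>x\<in>X. \<beta> x * f x)"
      if q: "deg_less (2 * n) q" and f: "\<And>x. x \<in> {-1..1} \<Longrightarrow> f x = poly q x / poly den x" for f q
    proof -
      have "wint w f = (\<Sum>x\<in>X. christoffel u n x * poly q x)"
        using wint_numerator[OF f] gauss_quadrature[OF u q] X by simp
      also have "\<dots> = (\<Sum>x\<in>X. \<beta> x * f x)"
      proof (rule sum.cong[OF refl])
        fix x assume "x \<in> X"
        from X1[OF this] show "christoffel u n x * poly q x = \<beta> x * f x"
          using den_pos[of x] by (simp add: \<beta>_def f)
      qed
      finally show ?thesis .
    qed
    show "is_gauss_nodes w n \<tau> t X"
      unfolding is_gauss_nodes_def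
    proof (intro conjI exI[of _ \<beta>] ballI)
      show "X \<subseteq> {-1<..<1}" using zeros_subset X by simp
      show "finite X" "card X = n" using orth_poly_factorization[OF u, of n] X by simp_all
      show "0 < \<beta> x" if "x \<in> X" for x
        unfolding \<beta>_def using that X X1 by (intro mult_pos_pos christoffel_pos[OF u] den_pos) auto
      show "wint w (rker (\<tau> j)) = (\<Sum>x\<in>X. \<beta> x * rker (\<tau> j) x)" if j: "j \<in> {1..2*n-1}" for j
      proof (rule exact[OF _ rker_eq(2)[OF j]])
        have "deg_less (Suc (2*n-1)) ([:1, t:] * Kj j)"
          using deg_less_Kj[OF j] by (auto simp: deg_less_coeff coeff_pCons split: nat.splits)
        then show "deg_less (2 * n) ([:1, t:] * Kj j)" using m by simp
      qed
      obtain L where "deg_less (Suc (2*n-1)) L"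
          and L: "\<And>x. x \<in> {-1..1} \<Longrightarrow> lead_fun (2*n-1) \<tau> t x = poly L x / poly den x"
        using lead_numerator by blast
      then have "deg_less (2 * n) L" using m by simp
      then show "wint w (lead_fun (2*n-1) \<tau> t) = (\<Sum>x\<in>X. \<beta> x * lead_fun (2*n-1) \<tau> t x)"
        using L by (rule exact)
    qed
  qed
qed

section \<open>Monotonicity of the quadrature nodes\<close>

lemma nodes_decreasing:
  assumes v: "pos_weight v" and N: "\<And>t X. t \<in> {-1<..<1} \<Longrightarrow> N t X \<longleftrightarrow> X = zeros (tilt v t) n"
    and i: "i \<in> {1..n}" and \<xi>: "\<xi> = (\<lambda>t. sorted_list_of_set (THE X. N t X) ! (i - 1))"
  shows "\<xi> C1_differentiable_on {-1<..<1} \<and> strict_antimono_on {-1<..<1} \<xi>"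
proof -
  define z where "z = (\<lambda>t. sorted_list_of_set (zeros (tilt v t) n) ! (i - 1))"
  have "i - 1 < n" using i by auto
  note z = zeros_tilt_decreasing[OF v this, folded z_def]
  have eq: "z t = \<xi> t" if "t \<in> {-1<..<1}" for t
  proof -
    have "(THE X. N t X) = zeros (tilt v t) n" by (rule the_equality) (simp_all add: N[OF that])
    then show ?thesis by (simp add: \<xi> z_def)
  qed
  obtain D where D: "continuous_on {-1<..<1} D" "\<And>t. t \<in> {-1<..<1} \<Longrightarrow> (z has_vector_derivative D t) (at t)"
    using z(1) unfolding C1_differentiable_on_def by blast
  have "(\<xi> has_vector_derivative D t) (at t)" if "t \<in> {-1<..<1}" for t
    using D(2)[OF that] open_greaterThanLessThan that eq
    by (rule has_vector_derivative_transform_within_open)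
  then have "\<xi> C1_differentiable_on {-1<..<1}"
    unfolding C1_differentiable_on_def using D(1) by blast
  moreover have "strict_antimono_on {-1<..<1} \<xi>"
  proof (rule monotone_onI)
    fix r s :: real assume rs: "r \<in> {-1<..<1}" "s \<in> {-1<..<1}" "r < s"
    then have "z r > z s" using z(2) by (rule monotone_onD[rotated])
    then show "\<xi> r > \<xi> s" using eq rs by simp
  qed
  ultimately show ?thesis by blast
qed

theorem theorem4:
  fixes w :: "real \<Rightarrow> real" and n :: nat
  assumes "w absolutely_integrable_on {-1..1}"
    and "AE x\<in>{-1..1} in lebesgue. 0 < w x"
    and "1 \<le> n"
  shows "(\<forall>\<tau>. \<tau> ` {1..n} \<subseteq> {-1<..<1} \<and> inj_on \<tau> {1..n} \<longrightarrow>
            (\<forall>t\<in>{-1<..<1}. \<exists>!X. is_orth_nodes w n \<tau> t X) \<and>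
            (\<forall>i\<in>{1..n}. orth_node w n \<tau> i C1_differentiable_on {-1<..<1} \<and>
                         strict_antimono_on {-1<..<1} (orth_node w n \<tau> i)))
       \<and> (\<forall>\<tau>. \<tau> ` {1..2*n-1} \<subseteq> {-1<..<1} \<and> inj_on \<tau> {1..2*n-1} \<longrightarrow>
            (\<forall>t\<in>{-1<..<1}. \<exists>!X. is_gauss_nodes w n \<tau> t X) \<and>
            (\<forall>i\<in>{1..n}. gauss_node w n \<tau> i C1_differentiable_on {-1<..<1} \<and>
                         strict_antimono_on {-1<..<1} (gauss_node w n \<tau> i)))"
proof (intro conjI[of "All _" "All _"] allI impI)
  have w: "pos_weight w" using assms by (simp add: pos_weight_def)
  \<comment> \<open>The weight whose tilts describe the nodes is the same for all parameters; any parameter yields its positivity.\<close>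
  have 0: "0 \<in> {-1<..<1::real}" by simp
  {
    fix \<tau> :: "nat \<Rightarrow> real" assume "\<tau> ` {1..n} \<subseteq> {-1<..<1} \<and> inj_on \<tau> {1..n}"
    then have tau: "\<tau> ` {1..n} \<subseteq> {-1<..<1}" "inj_on \<tau> {1..n}" by auto
    note O = is_orth_nodes_iff[OF w assms(3) tau]
    show "(\<forall>t\<in>{-1<..<1}. \<exists>!X. is_orth_nodes w n \<tau> t X) \<and>
        (\<forall>i\<in>{1..n}. orth_node w n \<tau> i C1_differentiable_on {-1<..<1} \<and>
                     strict_antimono_on {-1<..<1} (orth_node w n \<tau> i))"
    proof (intro conjI[of "Ball _ _" "Ball _ _"] ballI)
      show "\<exists>!X. is_orth_nodes w n \<tau> t X" if "t \<in> {-1<..<1}" for t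
        by (simp add: O(2)[OF that])
      show "orth_node w n \<tau> i C1_differentiable_on {-1<..<1} \<and>
          strict_antimono_on {-1<..<1} (orth_node w n \<tau> i)" if "i \<in> {1..n}" for i
        by (rule nodes_decreasing[OF O(1)[OF 0] O(2) that]) (simp_all add: orth_node_def fun_eq_iff)
    qed
  }
  {
    fix \<tau> :: "nat \<Rightarrow> real" assume "\<tau> ` {1..2*n-1} \<subseteq> {-1<..<1} \<and> inj_on \<tau> {1..2*n-1}"
    then have tau: "\<tau> ` {1..2*n-1} \<subseteq> {-1<..<1}" "inj_on \<tau> {1..2*n-1}" by auto
    note G = is_gauss_nodes_iff[OF w assms(3) tau]
    show "(\<forall>t\<in>{-1<..<1}. \<exists>!X. is_gauss_nodes w n \<tau> t X) \<and>
        (\<forall>i\<in>{1..n}. gauss_node w n \<tau> i C1_differentiable_on {-1<..<1} \<and>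
                     strict_antimono_on {-1<..<1} (gauss_node w n \<tau> i))"
    proof (intro conjI[of "Ball _ _" "Ball _ _"] ballI)
      show "\<exists>!X. is_gauss_nodes w n \<tau> t X" if "t \<in> {-1<..<1}" for t
        by (simp add: G(2)[OF that])
      show "gauss_node w n \<tau> i C1_differentiable_on {-1<..<1} \<and>
          strict_antimono_on {-1<..<1} (gauss_node w n \<tau> i)" if "i \<in> {1..n}" for i
        by (rule nodes_decreasing[OF G(1)[OF 0] G(2) that]) (simp_all add: gauss_node_def fun_eq_iff)
    qed
  }
qed

end
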